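(* Let $T\colon[0,1]\to[0,1]$ be the tent map, $T(x)=2x$ for $0\le x\le\frac12$ and $T(x)=2-2x$ for $\frac12<x\le1$. If $\mu$ is a Borel probability measure on $[0,1]$ invariant for $T$, then the set of points $x\in[0,1]$ that generate $\mu$ (also known as the statistical basin for $\mu$) is a $\mathbf{\Pi}^0_3$-complete set. The set of irregular points for $T$ is $\mathbf{\Sigma}^0_3$-complete.
   Context: $\mu$ is $T$-invariant if $\mu(B)=\mu(T^{-1}(B))$ for all Borel $B\subseteq[0,1]$. A point $x\in[0,1]$ generates $\mu$ if for every interval $I\subseteq[0,1]$ with $\mu(\partial I)=0$ (boundary taken in $[0,1]$) one has $\lim_{N\to\infty}\frac1N|\{0\le n<N: T^n(x)\in I\}|=\mu(I)$. Let $I_0=[0,1/2)$ and $I_1=[1/2,1)$, and for $a_1,\ldots,a_k\in\{0,1\}$ let $\Delta(a_1,\ldots,a_k)=\{y\in[0,1]: T^{j-1}(y)\in I_{a_j}\text{ for }1\le j\le k\}$. A point $x\in[0,1]$ is irregular for $T$ if there are $k\ge1$ and $a_1,\ldots,a_k\in\{0,1\}$ such that $\frac1N|\{0\le n<N:T^n(x)\in\Delta(a_1,\ldots,a_k)\}|$ does not converge as $N\to\infty$. In $[0,1]$: $\mathbf{\Sigma}^0_1$ = open sets, $\mathbf{\Pi}^0_k$ = complements of $\mathbf{\Sigma}^0_k$ sets, $\mathbf{\Sigma}^0_{k+1}$ = countable unions of $\mathbf{\Pi}^0_k$ sets. A set is $\mathbf{\Pi}^0_3$-complete if it is in $\mathbf{\Pi}^0_3\setminus\mathbf{\Sigma}^0_3$,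 and $\mathbf{\Sigma}^0_3$-complete if it is in $\mathbf{\Sigma}^0_3\setminus\mathbf{\Pi}^0_3$. *)

theory Defs
  imports "HOL-Probability.Probability"
begin

text \<open>Levels are numbered from 1; no set belongs to the junk level \<open>Sigma0 X 0\<close>.\<close>

fun Sigma0 :: "'a topology \<Rightarrow> nat \<Rightarrow> 'a set \<Rightarrow> bool" where
  "Sigma0 X 0 = (\<lambda>S. False)"
| "Sigma0 X (Suc 0) = openin X"
| "Sigma0 X (Suc (Suc k)) =
     countable union_of (\<lambda>S. S \<subseteq> topspace X \<and> Sigma0 X (Suc k) (topspace X - S))"

definition Pi0 :: "'a topology \<Rightarrow> nat \<Rightarrow> 'a set \<Rightarrow> bool" where
  "Pi0 X k S \<longleftrightarrow> S \<subseteq> topspace X \<and> Sigma0 X k (topspace X - S)"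

lemma Sigma0_Suc_Suc: "Sigma0 X (Suc (Suc k)) = countable union_of Pi0 X (Suc k)"
  by (simp add: Pi0_def [abs_def])

lemma Sigma0_2: "Sigma0 X 2 = fsigma_in X"
  by (simp add: numeral_2_eq_2 fsigma_in_def closedin_def [abs_def])

definition Pi03_complete :: "'a topology \<Rightarrow> 'a set \<Rightarrow> bool" where
  "Pi03_complete X S \<longleftrightarrow> Pi0 X 3 S \<and> \<not> Sigma0 X 3 S"

definition Sigma03_complete :: "'a topology \<Rightarrow> 'a set \<Rightarrow> bool" where
  "Sigma03_complete X S \<longleftrightarrow> Sigma0 X 3 S \<and> \<not> Pi0 X 3 S"

text \<open>Self-maps of the unit interval are total functions on the reals of which only the
  values on \<open>{0..1}\<close> are used; in particular preimages are intersected with \<open>{0..1}\<close>.\<close>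

definition tent_map :: "real \<Rightarrow> real" where
  "tent_map x = (if x \<le> 1/2 then 2 * x else 2 - 2 * x)"

definition borel_probability :: "real measure \<Rightarrow> bool" where
  "borel_probability \<mu> \<longleftrightarrow> prob_space \<mu> \<and> sets \<mu> = sets (restrict_space borel {0..1})"

definition invariant_for :: "(real \<Rightarrow> real) \<Rightarrow> real measure \<Rightarrow> bool" where
  "invariant_for T \<mu> \<longleftrightarrow>
     (\<forall>B \<in> sets (restrict_space borel {0..1}). measure \<mu> B = measure \<mu> (T -` B \<inter> {0..1}))"

definition visit_freq :: "(real \<Rightarrow> real) \<Rightarrow> real \<Rightarrow> real set \<Rightarrow> nat \<Rightarrow> real" where
  "visit_freq T x A N = real (card {n. n < N \<and> (T ^^ n) x \<in> A}) / real N"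

definition generates :: "(real \<Rightarrow> real) \<Rightarrow> real measure \<Rightarrow> real \<Rightarrow> bool" where
  "generates T \<mu> x \<longleftrightarrow>
     (\<forall>I. is_interval I \<and> I \<subseteq> {0..1} \<and> measure \<mu> (top_of_set {0..1} frontier_of I) = 0
        \<longrightarrow> visit_freq T x I \<longlonglongrightarrow> measure \<mu> I)"

definition basin :: "(real \<Rightarrow> real) \<Rightarrow> real measure \<Rightarrow> real set" where
  "basin T \<mu> = {x \<in> {0..1}. generates T \<mu> x}"

definition half_interval :: "nat \<Rightarrow> real set" where
  "half_interval a = (if a = 0 then {0..<1/2} else {1/2..<1})"

text \<open>Words are lists over \<open>{0, 1}\<close>. As list positions start at 0, position \<open>j\<close> constrains
  the \<open>j\<close>-th iterate.\<close>

definition cylinder :: "(real \<Rightarrow> real) \<Rightarrow> nat list \<Rightarrow> real set" where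
  "cylinder T as = {y \<in> {0..1}. \<forall>j < length as. (T ^^ j) y \<in> half_interval (as ! j)}"

definition irregular_points :: "(real \<Rightarrow> real) \<Rightarrow> real set" where
  "irregular_points T = {x \<in> {0..1}.
     \<exists>as. as \<noteq> [] \<and> set as \<subseteq> {0, 1} \<and> \<not> convergent (visit_freq T x (cylinder T as))}"

end

theory Submission
  imports Defs "HOL-Real_Asymp.Real_Asymp"
begin

text \<open>Membership in the two classes: by weak convergence, a point generates \<open>\<mu>\<close> iff the orbit
  averages of all monomials converge to the moments of \<open>\<mu>\<close>, and these averages are continuous in
  the point; the frequencies of visits to cylinders are continuous off an \<open>F\<^sub>\<sigma>\<close> set of points
  whose orbit is eventually 0.

  Hardness: points are coded by binary sequences on which the tent map acts as the shift, and
  changing a sequence in a set of places of density zero does not change the limits of orbit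
  averages. Start from a sequence coding a generic point of \<open>\<mu>\<close>, which exists for every invariant
  \<open>\<mu>\<close>, ergodic or not. Given \<open>z : \<nat> \<rightarrow> \<nat>\<close>, overwrite it after place \<open>j!\<close>, for about \<open>j! / (z j + 1)\<close>
  places, by the code of a fixed point whose value differs from the mean of \<open>\<mu>\<close>. The resulting point
  generates \<open>\<mu>\<close> if \<open>z\<close> tends to infinity, and otherwise its orbit averages diverge. A diagonal
  argument shows that the set of sequences tending to infinity is not \<open>\<Sigma>\<^sup>0\<^sub>3\<close>.\<close>

section \<open>The third level of the Borel hierarchy\<close>

text \<open>For a measure that is not ergodic, the set of its generic points may be a null set, so
  no ergodic theorem supplies one. Instead, orbit segments of lengths 1, 2, 3, ... are spliced,
  which is possible because every binary sequence is a code. Each new segment is chosen at a right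
  or obtuse angle to the error accumulated so far. As for orthogonal increments, the squares of the
  errors then add up: after q segments the error in each moment is of order q^(3/2), against an
  elapsed time of order q^2. Invariance enters through the existence of such a choice. The
  factorials in the overwriting meet two demands. At the start of a block the elapsed time must
  dwarf all earlier blocks, so that for every z the averages return to the moments along a
  subsequence; and for a value k taken infinitely often, late blocks must occupy exactly the
  fraction 1/(k+1) of the elapsed time, so that their effect on the averages can be read off. For
  the irregular points the point mass at 0 suffices: orbit averages tending to 0 already control the
  visits to every cylinder.\<close>

lemma Sigma0_3: "Sigma0 X 3 = countable union_of gdelta_in X"
proof -
  have "(\<lambda>S. S \<subseteq> topspace X \<and> Sigma0 X (Suc (Suc 0)) (topspace X - S)) = gdelta_in X"
    using Sigma0_2[of X] by (simp add: gdelta_in_fsigma_in fun_eq_iff numeral_2_eq_2)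
  then show ?thesis
    by (simp only: numeral_3_eq_3 Sigma0.simps(3))
qed

lemma Sigma0_3_UN:
  assumes "countable I" and "\<And>i. i \<in> I \<Longrightarrow> gdelta_in X (G i)"
  shows "Sigma0 X 3 (\<Union>i\<in>I. G i)"
  unfolding Sigma0_3 union_of_def using assms by (intro exI[of _ "G ` I"]) auto

lemma Sigma0_3_sequence:
  assumes "Sigma0 X 3 S"
  obtains U :: "nat \<Rightarrow> nat \<Rightarrow> 'a set" where "\<And>k m. openin X (U k m)" and "S = (\<Union>k. \<Inter>m. U k m)"
proof -
  obtain \<U> where \<U>: "countable \<U>" "\<And>G. G \<in> \<U> \<Longrightarrow> gdelta_in X G" "\<Union>\<U> = S"
    using assms unfolding Sigma0_3 union_of_def by auto
  \<comment> \<open>The empty set is added because only a nonempty family can be enumerated; it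
    leaves the union unchanged.\<close>
  define G where "G = from_nat_into (insert {} \<U>)"
  have range_G: "range G = insert {} \<U>"
    unfolding G_def using \<U>(1) by (intro range_from_nat_into) auto
  have "gdelta_in X (G k)" for k
    using \<U>(2) range_G by (cases "G k = {}") auto
  then have "\<exists>C :: nat \<Rightarrow> 'a set. (\<forall>m. openin X (C m)) \<and> (\<Inter>m. C m) = G k" for k
    unfolding gdelta_in_descending by metis
  then obtain U :: "nat \<Rightarrow> nat \<Rightarrow> 'a set" where U: "\<And>k m. openin X (U k m)" "\<And>k. (\<Inter>m. U k m) = G k"
    by metis
  have "(\<Union>k. \<Inter>m. U k m) = S"
    using \<U>(3) range_G U(2) by auto
  with U(1) that show ?thesis by blast
qed

text \<open>The sequences taking each value finitely often form a set that is not \<open>\<Sigma>\<^sup>0\<^sub>3\<close> in Baire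
  space. A condition \<open>(s, b)\<close> stands for the closed set of all extensions of \<open>s\<close> whose further
  values are at least \<open>b\<close>. A \<open>G\<^sub>\<delta>\<close> set dense in it contains an extension taking the value \<open>b\<close>
  infinitely often; hence a \<open>G\<^sub>\<delta>\<close> set of sequences tending to infinity is avoided by a
  stronger condition, and countably many such sets are avoided by a sequence tending to infinity.\<close>

definition extends :: "nat list \<Rightarrow> nat \<Rightarrow> (nat \<Rightarrow> nat) \<Rightarrow> bool" where
  "extends s b z \<longleftrightarrow> (\<forall>i < length s. z i = s ! i) \<and> (\<forall>i \<ge> length s. b \<le> z i)"

text \<open>Only the bound of the weaker condition occurs. That bounds increase along a sequence of
  conditions is demanded separately, by \<open>mono b\<close> in
  \<open>limit_sequence\<close>.\<close>

definition stronger :: "nat list \<Rightarrow> nat list \<Rightarrow> nat \<Rightarrow> bool" where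
  "stronger s' s b \<longleftrightarrow> (\<exists>t. s' = s @ t \<and> (\<forall>v \<in> set t. b \<le> v))"

lemma stronger_refl: "stronger s s b"
  by (simp add: stronger_def)

lemma stronger_trans: "stronger s'' s' b' \<Longrightarrow> stronger s' s b \<Longrightarrow> b \<le> b' \<Longrightarrow> stronger s'' s b"
  by (fastforce simp: stronger_def)

text \<open>An extension can be followed as far as desired without leaving the condition. The length
  \<open>n\<close> will be one at which continuity has decided membership in an open set.\<close>

lemma stronger_prefix:
  assumes "extends s b z"
  shows "\<exists>s'. stronger s' s b \<and> length s \<le> length s' \<and> n \<le> length s' \<and> extends s' b z"
proof -
  define m where "m = max n (length s)"
  define s' where "s' = map z [0..<m]"
  have "s' = s @ map z [length s..<m]"
  proof -
    have "map z [0..<length s] = s"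
      using assms by (intro nth_equalityI) (auto simp: extends_def)
    moreover have "[0..<m] = [0..<length s] @ [length s..<m]"
      using upt_add_eq_append[of 0 "length s" "m - length s"] by (simp add: m_def max_def split: if_splits)
    ultimately show ?thesis by (simp add: s'_def)
  qed
  then have "stronger s' s b"
    using assms by (auto simp: stronger_def extends_def)
  moreover have "extends s' b z"
    using assms by (auto simp: extends_def s'_def m_def)
  ultimately show ?thesis
    by (intro exI[of _ s']) (auto simp: s'_def m_def)
qed

text \<open>Fusion: the stems are nested and grow strictly, so they have a common limit. A value
  beyond the stem of stage \<open>m\<close> is added at a later stage, hence under a bound of at
  least \<open>b m\<close>.\<close>

lemma limit_sequence:
  fixes s :: "nat \<Rightarrow> nat list"
  assumes str: "\<And>m. stronger (s (Suc m)) (s m) (b m)" and len: "\<And>m. length (s m) < length (s (Suc m))"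
    and b: "mono b"
  obtains z where "\<And>m. extends (s m) (b m) z"
proof -
  have str': "stronger (s n) (s m) (b m)" if "m \<le> n" for m n
    using that
  proof (induction n rule: dec_induct)
    case (step n)
    then show ?case using stronger_trans[OF str[of n]] monoD[OF b] by blast
  qed (rule stronger_refl)
  have len': "m \<le> length (s m)" for m
    by (induction m) (use len in \<open>auto intro: less_le_trans Suc_leI simp: Suc_le_eq order.strict_trans1\<close>)
  \<comment> \<open>Lengths grow by at least 1 per stage, so stage \<open>Suc i\<close> is certain
    to have a position \<open>i\<close>.\<close>
  define z where "z i = s (Suc i) ! i" for i
  have z: "z i = s n ! i" if "i < length (s n)" for i n
  proof (cases "Suc i \<le> n")
    case True
    have "i < length (s (Suc i))" using len'[of "Suc i"] by simp
    with str'[OF True] show ?thesis by (auto simp: z_def stronger_def nth_append)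
  next
    case False
    then have "stronger (s (Suc i)) (s n) (b n)" by (intro str') simp
    with that show ?thesis by (auto simp: z_def stronger_def nth_append)
  qed
  have "extends (s m) (b m) z" for m
    unfolding extends_def
  proof (intro conjI allI impI)
    fix i assume i: "length (s m) \<le> i"
    have lt: "i < length (s (Suc i))" using len'[of "Suc i"] by simp
    have "m \<le> Suc i" using len'[of m] i by simp
    from str'[OF this] i lt show "b m \<le> z i"
      by (auto simp: z_def stronger_def nth_append)
  qed (rule z)
  then show ?thesis by (rule that)
qed

text \<open>A Baire category argument by hand: were the claim false, the dense open conditions could
  be met one after another, with a value \<open>b\<close> inserted between any two of them.\<close>

lemma avoid_gdelta:
  fixes f :: "(nat \<Rightarrow> nat) \<Rightarrow> 'a" and U :: "nat \<Rightarrow> 'a set"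
  assumes cont: "\<And>V z. openin X V \<Longrightarrow> f z \<in> V \<Longrightarrow> \<exists>n. \<forall>z'. (\<forall>i<n. z' i = z i) \<longrightarrow> f z' \<in> V"
    and U: "\<And>m. openin X (U m)"
    and fin: "\<And>z k. f z \<in> (\<Inter>m. U m) \<Longrightarrow> finite {j. z j = k}"
  shows "\<exists>s'. stronger s' s b \<and> length s < length s' \<and> (\<forall>z. extends s' b z \<longrightarrow> f z \<notin> (\<Inter>m. U m))"
proof (rule ccontr)
  assume neg: "\<not> ?thesis"
  have dense: "\<exists>z. extends s' b z \<and> f z \<in> (\<Inter>m. U m)" if "stronger s' s b" "length s < length s'" for s'
    using neg that by blast
  \<comment> \<open>Appending \<open>b\<close> respects the bound and makes the stem longer than
    \<open>s\<close>, as density requires; the stem is then prolonged until membership in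
    \<open>U m\<close> is decided.\<close>
  have ex: "\<exists>s''. stronger s'' (s' @ [b]) b \<and> length (s' @ [b]) \<le> length s'' \<and>
      (\<forall>z. extends s'' b z \<longrightarrow> f z \<in> U m)" if s': "stronger s' s b" for s' m
  proof -
    have "stronger (s' @ [b]) s b" "length s < length (s' @ [b])"
      using s' by (auto simp: stronger_def)
    from dense[OF this] obtain z where z: "extends (s' @ [b]) b z" "f z \<in> U m" by blast
    obtain n where n: "\<And>z'. (\<forall>i<n. z' i = z i) \<Longrightarrow> f z' \<in> U m"
      using cont[OF U z(2)] by blast
    obtain s'' where s'': "stronger s'' (s' @ [b]) b" "length (s' @ [b]) \<le> length s''"
      "n \<le> length s''" "extends s'' b z"
      using stronger_prefix[OF z(1)] by blast
    have "f z' \<in> U m" if "extends s'' b z'" for z'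
      using that s''(3,4) by (intro n) (auto simp: extends_def)
    with s'' show ?thesis by blast
  qed
  define P where "P m s' \<longleftrightarrow> stronger s' s b" for m :: nat and s'
  define Q where "Q m s' s'' \<longleftrightarrow> stronger s'' (s' @ [b]) b \<and> length (s' @ [b]) \<le> length s'' \<and>
      (\<forall>z. extends s'' b z \<longrightarrow> f z \<in> U m)" for m :: nat and s' s''
  obtain S where S: "\<And>m. P m (S m)" "\<And>m. Q m (S m) (S (Suc m))"
  proof (rule dependent_nat_choice[of P Q, THEN exE])
    show "\<exists>x. P 0 x" using stronger_refl by (auto simp: P_def)
    fix x n assume "P n x"
    then have "stronger x s b" by (simp add: P_def)
    from ex[OF this] obtain y where "Q n x y" unfolding Q_def by blast
    moreover from this \<open>stronger x s b\<close> have "P (Suc n) y"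
      unfolding P_def Q_def
      by (auto simp: stronger_def)
    ultimately show "\<exists>y. P (Suc n) y \<and> Q n x y" by blast
  qed blast
  have str: "stronger (S (Suc m)) (S m) b" for m
    using S(2)[of m] by (auto simp: Q_def stronger_def)
  have len: "length (S m) < length (S (Suc m))" for m
    using S(2)[of m] by (auto simp: Q_def)
  obtain z where z: "\<And>m. extends (S m) b z"
    using limit_sequence[of S "\<lambda>_. b", OF str len] by (auto simp: mono_def)
  have "f z \<in> U m" for m
    using S(2)[of m] z[of "Suc m"] by (auto simp: Q_def)
  then have "finite {j. z j = b}" by (intro fin) auto
  moreover have "z (length (S m)) = b" for m
  proof -
    obtain t where "S (Suc m) = (S m @ [b]) @ t"
      using S(2)[of m] by (auto simp: Q_def stronger_def)
    with z[of "Suc m"] show ?thesis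
      by (auto simp: extends_def nth_append)
  qed
  then have "range (\<lambda>m. length (S m)) \<subseteq> {j. z j = b}" by auto
  ultimately have "finite (range (\<lambda>m. length (S m)))" by (rule finite_subset[rotated])
  moreover have "strict_mono (\<lambda>m. length (S m))"
    using len by (intro strict_mono_Suc_iff[THEN iffD2]) auto
  ultimately show False
    using range_inj_infinite strict_mono_imp_inj_on by blast
qed

theorem not_Sigma0_3:
  fixes f :: "(nat \<Rightarrow> nat) \<Rightarrow> 'a"
  assumes cont: "\<And>V z. openin X V \<Longrightarrow> f z \<in> V \<Longrightarrow> \<exists>n. \<forall>z'. (\<forall>i<n. z' i = z i) \<longrightarrow> f z' \<in> V"
    and red: "\<And>z. f z \<in> S \<longleftrightarrow> (\<forall>k. finite {j. z j = k})"
  shows "\<not> Sigma0 X 3 S"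
proof
  assume "Sigma0 X 3 S"
  then obtain U :: "nat \<Rightarrow> nat \<Rightarrow> 'a set" where U: "\<And>k m. openin X (U k m)" "S = (\<Union>k. \<Inter>m. U k m)"
    using Sigma0_3_sequence[of X S] by blast
  have ex: "\<exists>s'. stronger s' s k \<and> length s < length s' \<and>
      (\<forall>z. extends s' k z \<longrightarrow> f z \<notin> (\<Inter>m. U k m))" for s k
  proof (rule avoid_gdelta[OF cont U(1)])
    fix z j assume "f z \<in> (\<Inter>m. U k m)"
    then have "f z \<in> S" using U(2) by blast
    then show "finite {i. z i = j}" using red by blast
  qed
  obtain s where s: "\<And>k. stronger (s (Suc k)) (s k) k \<and> length (s k) < length (s (Suc k)) \<and>
      (\<forall>z. extends (s (Suc k)) k z \<longrightarrow> f z \<notin> (\<Inter>m. U k m))"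
    using dependent_nat_choice[of "\<lambda>_ _. True" "\<lambda>k s s'. stronger s' s k \<and> length s < length s' \<and>
      (\<forall>z. extends s' k z \<longrightarrow> f z \<notin> (\<Inter>m. U k m))"] ex by auto
  obtain z where z: "\<And>k. extends (s k) k z"
    using limit_sequence[of s "\<lambda>k. k"] s by (auto simp: mono_def)
  have "finite {j. z j = k}" for k
  proof (rule finite_subset)
    show "{j. z j = k} \<subseteq> {..<length (s (Suc k))}"
      using z[of "Suc k"] by (auto simp: extends_def not_less[symmetric])
  qed simp
  then have "f z \<in> S" using red by blast
  then obtain k where "f z \<in> (\<Inter>m. U k m)" using U(2) by blast
  \<comment> \<open>Beyond \<open>s (Suc k)\<close> the limit even respects the bound
    \<open>Suc k\<close>; the \<open>k\<close>-th set was avoided for the weaker bound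
    \<open>k\<close>.\<close>
  moreover have "extends (s (Suc k)) k z"
    using z[of "Suc k"] by (auto simp: extends_def Suc_le_eq intro: less_imp_le)
  ultimately show False using s by blast
qed

section \<open>Binary coding of the tent map\<close>

definition binary_real :: "(nat \<Rightarrow> bool) \<Rightarrow> real" where
  "binary_real b = (\<Sum>i. of_bool (b i) / 2 ^ Suc i)"

lemma summable_binary_real: "summable (\<lambda>i. of_bool (b i) / 2 ^ Suc i :: real)"
proof (rule summable_comparison_test)
  show "\<exists>N. \<forall>n\<ge>N. norm (of_bool (b n) / 2 ^ Suc n :: real) \<le> (1/2) ^ Suc n"
    by (auto simp: power_one_over divide_simps)
  show "summable (\<lambda>n. (1 / 2 :: real) ^ Suc n)"
    using power_half_series by (rule sums_summable)
qed

lemma binary_real_Suc: "binary_real b = (of_bool (b 0) + binary_real (\<lambda>i. b (Suc i))) / 2"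
proof -
  have "binary_real b = of_bool (b 0) / 2 + (\<Sum>i. of_bool (b (Suc i)) / 2 ^ Suc (Suc i))"
    unfolding binary_real_def using suminf_split_head[OF summable_binary_real[of b]] by simp
  also have "(\<Sum>i. of_bool (b (Suc i)) / 2 ^ Suc (Suc i) :: real)
      = (\<Sum>i. of_bool (b (Suc i)) / 2 ^ Suc i / 2)"
    by (simp add: field_simps)
  also have "\<dots> = binary_real (\<lambda>i. b (Suc i)) / 2"
    unfolding binary_real_def by (rule suminf_divide[OF summable_binary_real])
  finally show ?thesis by (simp add: field_simps)
qed

lemma binary_real_bounds: "0 \<le> binary_real b" "binary_real b \<le> 1"
proof -
  show "0 \<le> binary_real b"
    unfolding binary_real_def by (rule suminf_nonneg[OF summable_binary_real]) simp
  have "binary_real b \<le> (\<Sum>n. (1/2) ^ Suc n)"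
    unfolding binary_real_def using sums_summable[OF power_half_series]
    by (intro suminf_le[OF _ summable_binary_real]) (auto simp: power_one_over divide_simps)
  then show "binary_real b \<le> 1" using sums_unique[OF power_half_series] by simp
qed

text \<open>Binary expansions turn the shift into doubling mod 1, not into the tent map. Folding
  them once by the tent map repairs this, since the tent map composed with doubling mod 1 agrees
  with its own square.\<close>

definition coded :: "(nat \<Rightarrow> bool) \<Rightarrow> real" where
  "coded b = tent_map (binary_real b)"

lemma tent_map_in: "x \<in> {0..1} \<Longrightarrow> tent_map x \<in> {0..1}"
  by (auto simp: tent_map_def)

lemma tent_map_funpow_in: "x \<in> {0..1} \<Longrightarrow> (tent_map ^^ n) x \<in> {0..1}"
  by (induction n) (simp_all only: funpow.simps comp_def id_apply tent_map_in)

lemma coded_in: "coded b \<in> {0..1}"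
  unfolding coded_def using binary_real_bounds[of b] by (intro tent_map_in) simp

lemma tent_map_lipschitz: "\<bar>tent_map x - tent_map y\<bar> \<le> 2 * \<bar>x - y\<bar>"
  by (auto simp: tent_map_def abs_if)

text \<open>If t is the value of the shifted sequence, then \<open>tent_map (binary_real b)\<close>
  is t or 1 - t according to the first digit, and the tent map takes the same value at both.\<close>

lemma tent_map_coded: "tent_map (coded b) = coded (\<lambda>i. b (Suc i))"
  using binary_real_Suc[of b] binary_real_bounds[of "\<lambda>i. b (Suc i)"]
  by (cases "b 0") (auto simp: coded_def tent_map_def field_simps)

lemma funpow_coded: "(tent_map ^^ n) (coded b) = coded (\<lambda>i. b (n + i))"
  by (induction n) (simp_all add: tent_map_coded)

text \<open>The distances \<open>e n\<close> of the \<open>n\<close>-th shifts satisfy \<open>2 * e n \<le> [a n \<noteq> b n] + e (n + 1)\<close>,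
  so summing them telescopes.\<close>

lemma sum_dist_coded:
  "(\<Sum>n<N. \<bar>coded (\<lambda>i. a (n + i)) - coded (\<lambda>i. b (n + i))\<bar>) \<le> 2 * (real (card {i. i < N \<and> a i \<noteq> b i}) + 1)"
proof -
  define e where "e n = \<bar>binary_real (\<lambda>i. a (n + i)) - binary_real (\<lambda>i. b (n + i))\<bar>" for n
  have e_le: "e n \<le> 1" for n
    unfolding e_def using binary_real_bounds[of "\<lambda>i. a (n + i)"] binary_real_bounds[of "\<lambda>i. b (n + i)"] by linarith
  have e_step: "2 * e n \<le> of_bool (a n \<noteq> b n) + e (Suc n)" for n
    unfolding e_def binary_real_Suc[of "\<lambda>i. a (n + i)"] binary_real_Suc[of "\<lambda>i. b (n + i)"]
    by (cases "a n"; cases "b n"; simp add: field_simps abs_if)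
  have card_Suc: "card {i. i < Suc N \<and> a i \<noteq> b i}
      = card {i. i < N \<and> a i \<noteq> b i} + of_bool (a N \<noteq> b N)" for N
  proof (cases "a N = b N")
    case True
    then have "{i. i < Suc N \<and> a i \<noteq> b i} = {i. i < N \<and> a i \<noteq> b i}"
      by (auto simp: less_Suc_eq)
    with True show ?thesis by simp
  next
    case False
    then have "{i. i < Suc N \<and> a i \<noteq> b i} = insert N {i. i < N \<and> a i \<noteq> b i}"
      by (auto simp: less_Suc_eq)
    with False show ?thesis by simp
  qed
  have "(\<Sum>n<N. e n) + e 0 \<le> real (card {i. i < N \<and> a i \<noteq> b i}) + e N"
  proof (induction N)
    case (Suc N)
    then show ?case using e_step[of N] unfolding card_Suc by simp
  qed simp
  then have "(\<Sum>n<N. e n) \<le> real (card {i. i < N \<and> a i \<noteq> b i}) + 1"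
    using e_le[of N] by (simp add: e_def) 
  moreover have "(\<Sum>n<N. \<bar>coded (\<lambda>i. a (n + i)) - coded (\<lambda>i. b (n + i))\<bar>) \<le> (\<Sum>n<N. 2 * e n)"
    unfolding coded_def e_def by (intro sum_mono tent_map_lipschitz)
  ultimately show ?thesis by (simp flip: sum_distrib_left)
qed

text \<open>The factor \<open>j\<close> is a Lipschitz constant of the \<open>j\<close>-th power on
  the unit interval.\<close>

lemma sum_dist_power_coded:
  "\<bar>(\<Sum>n<N. coded (\<lambda>i. a (n + i)) ^ j) - (\<Sum>n<N. coded (\<lambda>i. b (n + i)) ^ j)\<bar>
    \<le> 2 * real j * (real (card {i. i < N \<and> a i \<noteq> b i}) + 1)"
proof -
  have "\<bar>(\<Sum>n<N. coded (\<lambda>i. a (n + i)) ^ j) - (\<Sum>n<N. coded (\<lambda>i. b (n + i)) ^ j)\<bar>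
      \<le> (\<Sum>n<N. \<bar>coded (\<lambda>i. a (n + i)) ^ j - coded (\<lambda>i. b (n + i)) ^ j\<bar>)"
    unfolding sum_subtractf[symmetric] by (rule sum_abs)
  also have "\<dots> \<le> (\<Sum>n<N. real j * \<bar>coded (\<lambda>i. a (n + i)) - coded (\<lambda>i. b (n + i))\<bar>)"
    using norm_power_diff[of "coded _" "coded _" j] coded_in
    by (intro sum_mono) (auto simp: abs_of_nonneg)
  also have "\<dots> \<le> real j * (2 * (real (card {i. i < N \<and> a i \<noteq> b i}) + 1))"
    unfolding sum_distrib_left[symmetric] by (intro mult_left_mono sum_dist_coded) simp
  finally show ?thesis by (simp add: algebra_simps)
qed

text \<open>The digits are the itinerary under doubling. The error of the expansion of
  \<open>y\<close> is half the error for \<open>D y\<close> and never exceeds 1, so it vanishes.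
  \<open>D\<close> fixes 1, which therefore receives the digits 111...\<close>

lemma binary_real_surj:
  assumes "x \<in> {0..1}"
  obtains b where "binary_real b = x"
proof -
  define D :: "real \<Rightarrow> real" where "D y = (if 1/2 \<le> y then 2 * y - 1 else 2 * y)" for y
  define dig where "dig y i = (1/2 \<le> (D ^^ i) y)" for y i
  have D_in: "D y \<in> {0..1}" if "y \<in> {0..1}" for y
    using that by (auto simp: D_def)
  have step: "\<bar>y - binary_real (dig y)\<bar> = \<bar>D y - binary_real (dig (D y))\<bar> / 2" for y
  proof -
    have "(\<lambda>i. dig y (Suc i)) = dig (D y)"
      by (simp add: dig_def funpow_Suc_right fun_eq_iff del: funpow.simps)
    then have "binary_real (dig y) = (of_bool (1/2 \<le> y) + binary_real (dig (D y))) / 2"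
      using binary_real_Suc[of "dig y"] by (simp add: dig_def)
    then show ?thesis by (auto simp: D_def abs_if field_simps)
  qed
  have bound: "\<bar>y - binary_real (dig y)\<bar> \<le> (1/2) ^ n" if "y \<in> {0..1}" for y n
    using that
  proof (induction n arbitrary: y)
    case 0
    then show ?case using binary_real_bounds[of "dig y"] by auto
  next
    case (Suc n)
    then show ?case using Suc.IH[OF D_in[OF Suc.prems]] step[of y] by simp
  qed
  have "\<bar>x - binary_real (dig x)\<bar> \<le> 0"
    by (rule LIMSEQ_le_const[OF LIMSEQ_power_zero[of "1/2::real"]]) (use bound[OF assms] in auto)
  then show ?thesis using that[of "dig x"] by simp
qed

lemma coded_surj:
  assumes "x \<in> {0..1}"
  obtains b where "coded b = x"
proof -
  obtain b where "binary_real b = x / 2" using assms binary_real_surj[of "x/2"] by auto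
  with assms show ?thesis using that[of b] by (simp add: coded_def tent_map_def)
qed

section \<open>Existence of generic points\<close>

lemma sum_lessThan_add: "(\<Sum>n<a + b. f n) = (\<Sum>n<a. f n) + (\<Sum>n<b. f (a + n :: nat) :: real)"
  by (induction b) simp_all

definition power_sum :: "nat \<Rightarrow> real \<Rightarrow> nat \<Rightarrow> real" where
  "power_sum j x N = (\<Sum>n<N. ((tent_map ^^ n) x) ^ j)"

lemma power_sum_bounds:
  assumes "x \<in> {0..1}"
  shows "0 \<le> power_sum j x N" "power_sum j x N \<le> real N"
proof -
  have *: "0 \<le> (tent_map ^^ n) x" "(tent_map ^^ n) x \<le> 1" for n
    using tent_map_funpow_in[OF assms, of n] by auto
  show "0 \<le> power_sum j x N"
    unfolding power_sum_def using * by (intro sum_nonneg) simp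
  have "power_sum j x N \<le> (\<Sum>n<N. 1)"
    unfolding power_sum_def using * by (intro sum_mono power_le_one)
  then show "power_sum j x N \<le> real N" by simp
qed

lemma power_sum_coded: "power_sum j (coded b) N = (\<Sum>n<N. coded (\<lambda>i. b (n + i)) ^ j)"
  by (simp add: power_sum_def funpow_coded)

lemma power_sum_coded_add:
  "power_sum j (coded b) (M + N) = power_sum j (coded b) M + power_sum j (coded (\<lambda>i. b (M + i))) N"
  unfolding power_sum_coded sum_lessThan_add by (simp add: add.assoc)

lemma power_sum_coded_diff:
  "\<bar>power_sum j (coded a) N - power_sum j (coded b) N\<bar>
    \<le> 2 * real j * (real (card {i. i < N \<and> a i \<noteq> b i}) + 1)"
  unfolding power_sum_coded by (rule sum_dist_power_coded)

lemma tent_map_borel: "tent_map \<in> borel_measurable borel"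
  unfolding tent_map_def[abs_def] by measurable

lemma tent_map_measurable_restrict:
  "tent_map \<in> measurable (restrict_space borel {0..1}) (restrict_space borel {0..1})"
  using tent_map_in tent_map_borel by (intro measurable_restrict_space3) (auto simp: Pi_iff)

section \<open>Deviations from the moments of an invariant measure\<close>

locale invariant_measure =
  fixes \<mu> :: "real measure"
  assumes borel_probability: "borel_probability \<mu>"
    and invariant: "invariant_for tent_map \<mu>"
begin

sublocale prob_space \<mu>
  using borel_probability by (simp add: borel_probability_def)

lemma sets_eq: "sets \<mu> = sets (restrict_space borel {0..1})"
  using borel_probability by (simp add: borel_probability_def)

lemma space_eq: "space \<mu> = {0..1}"
  using sets_eq_imp_space_eq[OF sets_eq] by (simp add: space_restrict_space)

lemma measurable_from_borel: "f \<in> borel_measurable borel \<Longrightarrow> f \<in> measurable \<mu> M"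
  if "sets M = sets borel" for M :: "real measure"
  using measurable_cong_sets[OF sets_eq that] by (auto intro: measurable_restrict_space1)

lemma tent_map_measurable: "tent_map \<in> measurable \<mu> \<mu>"
  using tent_map_measurable_restrict measurable_cong_sets[OF sets_eq sets_eq] by simp

lemma distr_tent_map: "distr \<mu> \<mu> tent_map = \<mu>"
proof (rule measure_eqI)
  fix A assume "A \<in> sets (distr \<mu> \<mu> tent_map)"
  then have A: "A \<in> sets \<mu>" by simp
  then have "measure \<mu> A = measure \<mu> (tent_map -` A \<inter> space \<mu>)"
    using invariant by (simp add: invariant_for_def sets_eq space_eq)
  then show "emeasure (distr \<mu> \<mu> tent_map) A = emeasure \<mu> A"
    using A tent_map_measurable by (simp add: emeasure_distr emeasure_eq_measure)
qed simp

definition moment :: "nat \<Rightarrow> real" where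
  "moment j = integral\<^sup>L \<mu> (\<lambda>x. x ^ j)"

lemma power_measurable: "(\<lambda>x. ((tent_map ^^ n) x) ^ j) \<in> borel_measurable \<mu>"
proof -
  have "tent_map ^^ n \<in> borel_measurable borel"
    using tent_map_borel by (induction n) (auto simp del: funpow.simps simp: funpow_Suc_right intro: measurable_comp)
  then show ?thesis by (intro borel_measurable_power measurable_from_borel refl)
qed

lemma integrable_power: "integrable \<mu> (\<lambda>x. ((tent_map ^^ n) x) ^ j)"
proof (rule integrable_const_bound[of _ 1])
  show "AE x in \<mu>. norm (((tent_map ^^ n) x) ^ j) \<le> 1"
  proof (rule AE_I2)
    fix x assume "x \<in> space \<mu>"
    then have "(tent_map ^^ n) x \<in> {0..1}" by (intro tent_map_funpow_in) (simp add: space_eq)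
    then show "norm (((tent_map ^^ n) x) ^ j) \<le> 1" by (simp add: power_le_one)
  qed
qed (rule power_measurable)

lemma integral_power: "integral\<^sup>L \<mu> (\<lambda>x. ((tent_map ^^ n) x) ^ j) = moment j"
proof (induction n)
  case (Suc n)
  have "integral\<^sup>L \<mu> (\<lambda>x. ((tent_map ^^ Suc n) x) ^ j)
      = integral\<^sup>L \<mu> (\<lambda>x. ((tent_map ^^ n) (tent_map x)) ^ j)"
    by (simp only: funpow_Suc_right comp_apply)
  also have "\<dots> = integral\<^sup>L (distr \<mu> \<mu> tent_map) (\<lambda>x. ((tent_map ^^ n) x) ^ j)"
    using tent_map_measurable power_measurable by (rule integral_distr[symmetric])
  finally show ?case using Suc.IH by (simp only: distr_tent_map)
qed (simp add: moment_def)

lemma moment_bounds: "0 \<le> moment j" "moment j \<le> 1"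
proof -
  have "x ^ j \<in> {0..1}" if "x \<in> space \<mu>" for x
    using that by (auto simp: space_eq power_le_one)
  then show "0 \<le> moment j" "moment j \<le> 1"
    unfolding moment_def using integrable_power[of 0 j]
    by (auto intro!: integral_nonneg_AE integral_le_const)
qed

definition deviation :: "nat \<Rightarrow> nat \<Rightarrow> real \<Rightarrow> real" where
  "deviation j N x = power_sum j x N - real N * moment j"

lemma deviation_bound:
  assumes "x \<in> {0..1}"
  shows "\<bar>deviation j N x\<bar> \<le> real N"
proof -
  have "0 \<le> real N * moment j" "real N * moment j \<le> real N"
    using moment_bounds[of j] by (auto simp: mult_left_le)
  then show ?thesis
    using power_sum_bounds[OF assms, of j N] by (simp add: deviation_def)
qed

text \<open>By invariance the integrand has integral 0.\<close>

lemma ex_nonpos_combination: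
  "\<exists>x\<in>{0..1}. (\<Sum>j<q. c j * deviation j N x) \<le> 0"
proof (rule ccontr)
  assume "\<not> ?thesis"
  then have pos: "0 < (\<Sum>j<q. c j * deviation j N x)" if "x \<in> space \<mu>" for x
    using that by (force simp: space_eq)
  have int: "integrable \<mu> (\<lambda>x. c j * deviation j N x)" for j
    unfolding deviation_def power_sum_def
    by (intro integrable_mult_right Bochner_Integration.integrable_diff
        Bochner_Integration.integrable_sum integrable_power integrable_const)
  have "0 < integral\<^sup>L \<mu> (\<lambda>x. \<Sum>j<q. c j * deviation j N x)"
    using pos by (intro expectation_greater AE_I2 Bochner_Integration.integrable_sum int)
  also have "\<dots> = (\<Sum>j<q. c j * integral\<^sup>L \<mu> (deviation j N))"
    using int by (simp add: Bochner_Integration.integral_sum)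
  also have "\<dots> = 0"
  proof -
    have "integral\<^sup>L \<mu> (deviation j N) = 0" for j
    unfolding deviation_def[abs_def] power_sum_def
    by (subst Bochner_Integration.integral_diff)
      (auto simp: Bochner_Integration.integral_sum integrable_power integral_power prob_space)
    then show ?thesis by simp
  qed
  finally show False by simp
qed

text \<open>Greedy choice: as long as the \<open>q\<close>-th point makes a nonpositive inner product with the
  deviations accumulated so far, their weighted sum of squares grows at most by the square of
  the length \<open>q + 1\<close> of the new orbit segment.\<close>

lemma greedy_points:
  obtains y :: "nat \<Rightarrow> real" and C :: "nat \<Rightarrow> real" where "\<And>q. y q \<in> {0..1}" and "\<And>j. 0 < C j"
    and "\<And>j q. j < q \<Longrightarrow> (\<Sum>i<q. deviation j (Suc i) (y i))\<^sup>2 \<le> C j * real q ^ 3"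
proof -
  \<comment> \<open>The factor \<open>(1/2) ^ Suc j\<close> keeps the total weight below 1. The
    fourth power pays for the moment \<open>j\<close> at its late entry into the sum, when its error
    may already be as large as \<open>(real (Suc j))\<^sup>2\<close>.\<close>
  define w :: "nat \<Rightarrow> real" where "w j = (1/2) ^ Suc j / real (Suc j) ^ 4" for j
  have w_pos: "0 < w j" for j by (simp add: w_def)
  have w_sum: "(\<Sum>j<q. w j) \<le> 1" for q
  proof -
    have "(\<Sum>j<q. w j) \<le> (\<Sum>j<q. (1/2) ^ Suc j)"
      unfolding w_def by (intro sum_mono) (simp add: divide_le_eq mult_left_le)
    also have "\<dots> \<le> (\<Sum>j. (1/2) ^ Suc j)"
      using sums_summable[OF power_half_series] by (intro sum_le_suminf) auto
    also have "\<dots> = 1" using sums_unique[OF power_half_series] by simp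
    finally show ?thesis .
  qed
  have w_diag: "w j * real (Suc j) ^ 4 \<le> 1" for j
    using power_le_one[of "1/2 :: real" "Suc j"] by (simp add: w_def)
  define Y where "Y q D = (SOME x. x \<in> {0..1} \<and> (\<Sum>j<q. w j * D j * deviation j (Suc q) x) \<le> 0)"
    for q and D :: "nat \<Rightarrow> real"
  have Y: "Y q D \<in> {0..1} \<and> (\<Sum>j<q. w j * D j * deviation j (Suc q) (Y q D)) \<le> 0" for q D
    unfolding Y_def by (rule someI_ex) (use ex_nonpos_combination[where q = q and c = "\<lambda>j. w j * D j" and N = "Suc q"] in blast)
  \<comment> \<open>The next point depends on all errors accumulated so far, so the recursion runs
    over the function of errors, and the points are read off from it.\<close>
  define D where "D = rec_nat (\<lambda>_. 0) (\<lambda>q D j. D j + deviation j (Suc q) (Y q D))"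
  define y where "y q = Y q (D q)" for q
  have D_0: "D 0 j = 0" and D_Suc: "D (Suc q) j = D q j + deviation j (Suc q) (y q)" for q j
    by (simp_all add: D_def y_def)
  have y_in: "y q \<in> {0..1}" for q using Y by (simp add: y_def)
  have D_sum: "D q j = (\<Sum>i<q. deviation j (Suc i) (y i))" for q j
    by (induction q) (simp_all add: D_0 D_Suc)
  have D_bound: "\<bar>D q j\<bar> \<le> real q ^ 2" for q j
  proof (induction q)
    case (Suc q)
    have "\<bar>D (Suc q) j\<bar> \<le> real q ^ 2 + real (Suc q)"
      unfolding D_Suc using Suc deviation_bound[OF y_in[of q], of j "Suc q"] by linarith
    also have "\<dots> \<le> real (Suc q) ^ 2" by (simp add: power2_eq_square algebra_simps)
    finally show ?case .
  qed (simp add: D_0)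
  \<comment> \<open>Cubic growth is the aim: each error is then of order q^(3/2), negligible against
    the total length of the segments, which is of order q^2.\<close>
  have R: "(\<Sum>j<q. w j * (D q j)\<^sup>2) \<le> real q * (real q ^ 2 + 1)" for q
  proof (induction q)
    case (Suc q)
    \<comment> \<open>The inner product controlled by the choice of \<open>y q\<close> runs over
      \<open>j < q\<close> only, so the term \<open>q\<close>, which enters now, is bounded
      trivially by means of its weight.\<close>
    have new: "w q * (D (Suc q) q)\<^sup>2 \<le> 1"
    proof -
      have "(D (Suc q) q)\<^sup>2 \<le> (real (Suc q) ^ 2)\<^sup>2"
        using D_bound[of "Suc q" q] by (intro abs_le_square_iff[THEN iffD1]) (simp add: abs_of_nonneg)
      then have "w q * (D (Suc q) q)\<^sup>2 \<le> w q * real (Suc q) ^ 4"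
        using w_pos[of q] by (intro mult_left_mono) (auto simp flip: power_mult)
      with w_diag[of q] show ?thesis by linarith
    qed
    let ?\<delta> = "\<lambda>j. deviation j (Suc q) (y q)"
    have "(\<Sum>j<q. w j * (D (Suc q) j)\<^sup>2)
        = (\<Sum>j<q. w j * (D q j)\<^sup>2) + 2 * (\<Sum>j<q. w j * D q j * ?\<delta> j) + (\<Sum>j<q. w j * (?\<delta> j)\<^sup>2)"
      unfolding D_Suc sum_distrib_left sum.distrib[symmetric]
      by (intro sum.cong refl) (simp add: power2_eq_square algebra_simps)
    also have "(\<Sum>j<q. w j * D q j * ?\<delta> j) \<le> 0"
      using Y[of q "D q"] by (simp add: y_def)
    also have "(\<Sum>j<q. w j * (?\<delta> j)\<^sup>2) \<le> (\<Sum>j<q. w j * (real (Suc q))\<^sup>2)"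
    proof (intro sum_mono mult_left_mono)
      fix j
      show "(?\<delta> j)\<^sup>2 \<le> (real (Suc q))\<^sup>2"
        using deviation_bound[OF y_in[of q], of j "Suc q"]
        by (intro abs_le_square_iff[THEN iffD1]) simp
    qed (use w_pos in \<open>auto intro: less_imp_le\<close>)
    also have "\<dots> = (\<Sum>j<q. w j) * (real (Suc q))\<^sup>2"
      by (simp add: sum_distrib_right)
    also have "\<dots> \<le> 1 * (real (Suc q))\<^sup>2"
      by (intro mult_right_mono w_sum) simp
    finally have "(\<Sum>j<q. w j * (D (Suc q) j)\<^sup>2) \<le> real q * (real q ^ 2 + 1) + (real (Suc q))\<^sup>2"
      using Suc.IH by simp
    with new have "(\<Sum>j<Suc q. w j * (D (Suc q) j)\<^sup>2)
        \<le> real q * (real q ^ 2 + 1) + (real (Suc q))\<^sup>2 + 1" by simp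
    also have "\<dots> \<le> real (Suc q) * (real (Suc q) ^ 2 + 1)"
      by (simp add: power2_eq_square algebra_simps)
    finally show ?case .
  qed simp
  have "(\<Sum>i<q. deviation j (Suc i) (y i))\<^sup>2 \<le> 2 / w j * real q ^ 3" if "j < q" for j q
  proof -
    have "w j * (D q j)\<^sup>2 \<le> (\<Sum>j<q. w j * (D q j)\<^sup>2)"
      using that less_imp_le[OF w_pos] by (intro member_le_sum) simp_all
    also note R[of q]
    also have "real q * (real q ^ 2 + 1) \<le> real q * (2 * real q ^ 2)"
      using that by (intro mult_left_mono) auto
    finally have "w j * (D q j)\<^sup>2 \<le> 2 * real q ^ 3"
      by (simp add: power2_eq_square power3_eq_cube algebra_simps)
    then show ?thesis
      using w_pos[of j] unfolding D_sum by (simp add: field_simps)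
  qed
  with y_in w_pos show ?thesis using that[of y "\<lambda>j. 2 / w j"] by simp
qed

text \<open>The codes of the greedy points are concatenated, the \<open>q\<close>-th one cut after
  \<open>q + 1\<close> digits. A time inside segment \<open>q\<close> adds an unfinished piece of
  length at most \<open>q\<close>, which is small against the roughly q^2/2 digits before
  it.\<close>

lemma generic_digits:
  obtains g where "\<And>j. (\<lambda>N. power_sum j (coded g) N / real N) \<longlonglongrightarrow> moment j"
proof -
  obtain y C where y: "\<And>q. y q \<in> {0..1}" and C: "\<And>j. 0 < C j"
    "\<And>j q. j < q \<Longrightarrow> (\<Sum>i<q. deviation j (Suc i) (y i))\<^sup>2 \<le> C j * real q ^ 3"
    by (rule greedy_points) blast
  have "\<exists>a. coded a = y q" for q
    using coded_surj[OF y[of q]] by metis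
  then obtain a where a: "\<And>q. coded (a q) = y q" by metis
  \<comment> \<open>The Cantor pairing does the bookkeeping: place \<open>triangle q + m\<close>
    with \<open>m \<le> q\<close> decodes to \<open>(m, q - m)\<close>, so the sum of the pair is
    the segment and its first entry the offset.\<close>
  define g where "g i = (case prod_decode i of (m, n) \<Rightarrow> a (m + n) m)" for i
  have g: "g (triangle q + m) = a q m" if "m \<le> q" for q m
  proof -
    have "prod_decode (triangle q + m) = prod_decode (prod_encode (m, q - m))"
      using that by (simp add: prod_encode_def)
    with that show ?thesis by (simp add: g_def)
  qed
  \<comment> \<open>A segment agrees with its model in all its digits, but the digits after it
    differ, which costs at most \<open>2 * real j\<close> per segment.\<close>
  have blocks: "\<bar>power_sum j (coded g) (triangle q) - (\<Sum>i<q. power_sum j (y i) (Suc i))\<bar> \<le> 2 * real j * real q"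
    for j q
  proof (induction q)
    case (Suc q)
    have "{i. i < Suc q \<and> g (triangle q + i) \<noteq> a q i} = {}"
      using g[of _ q] by auto
    then have "\<bar>power_sum j (coded (\<lambda>i. g (triangle q + i))) (Suc q) - power_sum j (y q) (Suc q)\<bar> \<le> 2 * real j"
      using power_sum_coded_diff[of j "\<lambda>i. g (triangle q + i)" "Suc q" "a q"]
      by (simp only: a card.empty of_nat_0 add_0 mult_1_right)
    moreover have "power_sum j (coded g) (triangle (Suc q))
        = power_sum j (coded g) (triangle q) + power_sum j (coded (\<lambda>i. g (triangle q + i))) (Suc q)"
      unfolding triangle_Suc by (rule power_sum_coded_add)
    ultimately show ?case using Suc by (simp add: algebra_simps)
  qed (simp add: power_sum_def)
  have tri_sum: "real (triangle q) = (\<Sum>i<q. real (Suc i))" for q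
    by (induction q) simp_all
  have tri: "real (triangle q) = real q * (real q + 1) / 2" for q
    by (induction q) (simp_all add: field_simps)
  \<comment> \<open>Three errors: from splicing the segments, from the accumulated deviations, and
    from the unfinished last segment.\<close>
  define r where "r j x = 2 * real j * x + sqrt (C j * x ^ 3) + x" for j and x :: real
  have dev: "\<bar>deviation j (triangle q + m) (coded g)\<bar> \<le> r j (real q)" if "j < q" "m \<le> q" for j q m
  proof -
    have "deviation j (triangle q + m) (coded g)
        = deviation j (triangle q) (coded g) + deviation j m (coded (\<lambda>i. g (triangle q + i)))"
      unfolding deviation_def power_sum_coded_add by (simp add: algebra_simps)
    moreover have "\<bar>deviation j m (coded (\<lambda>i. g (triangle q + i)))\<bar> \<le> real q"
      using deviation_bound[OF coded_in, of j m "\<lambda>i. g (triangle q + i)"] that(2) by linarith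
    moreover have "\<bar>\<Sum>i<q. deviation j (Suc i) (y i)\<bar> \<le> sqrt (C j * real q ^ 3)"
      using C(2)[OF that(1)] by (intro real_le_rsqrt) simp
    moreover have "deviation j (triangle q) (coded g) = (power_sum j (coded g) (triangle q)
        - (\<Sum>i<q. power_sum j (y i) (Suc i))) + (\<Sum>i<q. deviation j (Suc i) (y i))"
      unfolding deviation_def tri_sum sum_subtractf sum_distrib_right by simp
    ultimately show ?thesis
      using blocks[of j q] unfolding r_def by linarith
  qed
  define block where "block N = (case prod_decode N of (m, n) \<Rightarrow> m + n)" for N
  have block: "\<exists>m\<le>block N. N = triangle (block N) + m" for N
  proof -
    obtain m n where mn: "prod_decode N = (m, n)" by (cases "prod_decode N")
    then have "N = prod_encode (m, n)" by (metis prod_decode_inverse)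
    with mn show ?thesis by (auto simp: block_def prod_encode_def)
  qed
  have lim_block: "filterlim block at_top sequentially"
    unfolding filterlim_at_top eventually_sequentially
  proof (intro allI exI impI)
    fix Q N assume "triangle Q \<le> N"
    show "Q \<le> block N"
    proof (rule ccontr)
      assume "\<not> Q \<le> block N"
      then have "Suc (block N) \<le> Q" by simp
      have "mono triangle" by (intro mono_iff_le_Suc[THEN iffD2]) simp
      from monoD[OF this \<open>Suc (block N) \<le> Q\<close>] have "triangle (block N) + Suc (block N) \<le> N"
        using \<open>triangle Q \<le> N\<close> by simp
      moreover obtain m where "m \<le> block N" "N = triangle (block N) + m" using block by blast
      ultimately show False by linarith
    qed
  qed
  have "(\<lambda>N. power_sum j (coded g) N / real N) \<longlonglongrightarrow> moment j" for j
  proof (rule LIM_zero_cancel, rule Lim_null_comparison)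
    have "C j > 0" by (rule C)
    then have "((\<lambda>x. r j x / (x * (x + 1) / 2)) \<longlongrightarrow> 0) at_top"
      unfolding r_def by real_asymp
    then show "((\<lambda>N. r j (real (block N)) / real (triangle (block N))) \<longlongrightarrow> 0) sequentially"
      unfolding tri
      by (rule filterlim_compose) (rule filterlim_compose[OF filterlim_real_sequentially lim_block])
    have "eventually (\<lambda>N. Suc j \<le> block N) sequentially"
      using lim_block by (simp add: filterlim_at_top)
    then show "\<forall>\<^sub>F N in sequentially. norm (power_sum j (coded g) N / real N - moment j)
        \<le> r j (real (block N)) / real (triangle (block N))"
    proof eventually_elim
      case (elim N)
      obtain m where m: "m \<le> block N" "N = triangle (block N) + m" using block by blast
      have pos: "0 < triangle (block N)"
        using elim by (cases "block N") auto
      then have N: "0 < N" "triangle (block N) \<le> N" using m(2) by linarith+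
      have "norm (power_sum j (coded g) N / real N - moment j) = \<bar>deviation j N (coded g)\<bar> / real N"
        using N by (simp add: deviation_def field_simps abs_divide flip: abs_mult)
      also have "\<dots> \<le> r j (real (block N)) / real N"
        using dev[of j "block N" m] elim m by (intro divide_right_mono) simp_all
      also have "\<dots> \<le> r j (real (block N)) / real (triangle (block N))"
        using pos N C[of j] by (intro divide_left_mono) (auto simp: r_def less_imp_le)
      finally show ?case .
    qed
  qed
  then show ?thesis by (rule that)
qed

end

section \<open>Spoiling a generic point\<close>

lemma binary_real_close: "(\<And>i. i < n \<Longrightarrow> a i = b i) \<Longrightarrow> \<bar>binary_real a - binary_real b\<bar> \<le> (1/2) ^ n"
proof (induction n arbitrary: a b)
  case 0
  then show ?case using binary_real_bounds[of a] binary_real_bounds[of b] by simp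
next
  case (Suc n)
  have *: "\<bar>binary_real (\<lambda>i. a (Suc i)) - binary_real (\<lambda>i. b (Suc i))\<bar> \<le> (1/2) ^ n"
    using Suc.prems by (intro Suc.IH) simp
  have "a 0 = b 0" using Suc.prems by simp
  then have eq: "binary_real a - binary_real b = (binary_real (\<lambda>i. a (Suc i)) - binary_real (\<lambda>i. b (Suc i))) / 2"
    by (simp add: binary_real_Suc[of a] binary_real_Suc[of b] field_simps)
  show ?case unfolding eq using * by simp
qed

lemma coded_close:
  assumes "\<And>i. i < n \<Longrightarrow> a i = b i"
  shows "\<bar>coded a - coded b\<bar> \<le> 2 * (1/2) ^ n"
proof -
  have "\<bar>binary_real a - binary_real b\<bar> \<le> (1/2) ^ n" using assms by (rule binary_real_close)
  then show ?thesis
    using tent_map_lipschitz[of "binary_real a" "binary_real b"] by (simp only: coded_def) (rule order.trans, assumption, simp)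
qed

text \<open>The times form a sequence \<open>s\<close> because the lemma serves twice: along all
  times when z tends to infinity, and along the factorials for every z.\<close>

lemma power_average_transfer:
  assumes lim: "(\<lambda>N. power_sum j (coded g) N / real N) \<longlonglongrightarrow> m"
    and s: "filterlim s at_top sequentially"
    and density: "(\<lambda>k. real (card {i. i < s k \<and> a i \<noteq> g i}) / real (s k)) \<longlonglongrightarrow> 0"
  shows "(\<lambda>k. power_sum j (coded a) (s k) / real (s k)) \<longlonglongrightarrow> m"
proof -
  let ?d = "\<lambda>k. real (card {i. i < s k \<and> a i \<noteq> g i})"
  have inv: "(\<lambda>k. 1 / real (s k)) \<longlonglongrightarrow> 0"
    by (rule filterlim_compose[OF lim_1_over_n s])
  have "(\<lambda>k. power_sum j (coded a) (s k) / real (s k) - power_sum j (coded g) (s k) / real (s k)) \<longlonglongrightarrow> 0"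
  proof (rule Lim_null_comparison)
    show "\<forall>\<^sub>F k in sequentially. norm (power_sum j (coded a) (s k) / real (s k) - power_sum j (coded g) (s k) / real (s k))
        \<le> 2 * real j * (?d k / real (s k) + 1 / real (s k))"
    proof (intro always_eventually allI)
      fix k
      have "norm (power_sum j (coded a) (s k) / real (s k) - power_sum j (coded g) (s k) / real (s k))
          = \<bar>power_sum j (coded a) (s k) - power_sum j (coded g) (s k)\<bar> / real (s k)"
        by (simp add: diff_divide_distrib[symmetric] abs_divide)
      also have "\<dots> \<le> (2 * real j * (?d k + 1)) / real (s k)"
        by (intro divide_right_mono power_sum_coded_diff) simp
      finally show "norm (power_sum j (coded a) (s k) / real (s k) - power_sum j (coded g) (s k) / real (s k))
        \<le> 2 * real j * (?d k / real (s k) + 1 / real (s k))"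
        by (simp only: times_divide_eq_right[symmetric] add_divide_distrib)
    qed
    show "(\<lambda>k. 2 * real j * (?d k / real (s k) + 1 / real (s k))) \<longlonglongrightarrow> 0"
      using tendsto_mult_right_zero[OF tendsto_add_zero[OF density inv]] .
  qed
  moreover have "(\<lambda>k. power_sum j (coded g) (s k) / real (s k)) \<longlonglongrightarrow> m"
    by (rule filterlim_compose[OF lim s])
  ultimately show ?thesis by (rule Lim_transform[rotated])
qed

text \<open>Factorials are chosen because \<open>fact j\<close> is negligible against
  \<open>fact (Suc j)\<close>, and because any given \<open>k + 1\<close> divides
  \<open>fact j\<close> for all large \<open>j\<close>, so that the division leaves no
  remainder.\<close>

definition overwritten :: "(nat \<Rightarrow> nat) \<Rightarrow> nat set" where
  "overwritten z = {i. \<exists>j. fact j \<le> i \<and> i < fact j + fact j div (z j + 1)}"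

definition overwrite :: "(nat \<Rightarrow> bool) \<Rightarrow> (nat \<Rightarrow> bool) \<Rightarrow> (nat \<Rightarrow> nat) \<Rightarrow> nat \<Rightarrow> bool" where
  "overwrite b g z i = (if i \<in> overwritten z then b i else g i)"

text \<open>As \<open>j \<le> fact j\<close>, the value \<open>z j\<close> affects no place before
  \<open>j\<close>. This gives the continuity of the reduction.\<close>

lemma overwrite_cong:
  assumes "\<And>i. i < n \<Longrightarrow> z i = z' i" and "i < n"
  shows "overwrite b g z i = overwrite b g z' i"
proof -
  have "z j = z' j" if "fact j \<le> i" for j
    using assms fact_ge_self[of j] that by simp
  then have "i \<in> overwritten z \<longleftrightarrow> i \<in> overwritten z'"
    by (auto simp: overwritten_def)
  then show ?thesis by (simp add: overwrite_def)
qed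

text \<open>No block is longer than the place where it starts, so the blocks up to \<open>j\<close>
  lie below \<open>2 * fact j\<close>. Only the block \<open>Suc j\<close> has to be counted
  precisely.\<close>

lemma card_overwrite_le:
  assumes "N \<le> fact (Suc (Suc j))"
  shows "card {i. i < N \<and> overwrite b g z i \<noteq> g i} \<le> 2 * fact j + fact (Suc j) div (z (Suc j) + 1)"
    (is "card ?E \<le> _ + ?B")
proof -
  have "?E \<subseteq> {..<2 * fact j} \<union> {fact (Suc j)..<fact (Suc j) + ?B}"
  proof
    fix i assume "i \<in> ?E"
    then obtain k where k: "fact k \<le> i" "i < fact k + fact k div (z k + 1)" and i: "i < N"
      by (auto simp: overwrite_def overwritten_def split: if_splits)
    have "k < Suc (Suc j)"
    proof (rule ccontr)
      assume "\<not> k < Suc (Suc j)"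
      then have "fact (Suc (Suc j)) \<le> (fact k :: nat)" by (intro fact_mono) simp
      with k i assms show False by linarith
    qed
    then consider "k = Suc j" | "k \<le> j" by linarith
    then show "i \<in> {..<2 * fact j} \<union> {fact (Suc j)..<fact (Suc j) + ?B}"
    proof cases
      case 1
      with k show ?thesis by simp
    next
      case 2
      then have "fact k \<le> (fact j :: nat)" by (rule fact_mono)
      moreover have "fact k div (z k + 1) \<le> fact k" by (rule div_le_dividend)
      ultimately have "i < 2 * fact j" using k by linarith
      then show ?thesis by simp
    qed
  qed
  then have "card ?E \<le> card ({..<2 * fact j} \<union> {fact (Suc j)..<fact (Suc j) + ?B} :: nat set)"
    by (intro card_mono) auto
  also have "\<dots> \<le> 2 * fact j + ?B"
    using card_Un_le[of "{..<2 * fact j :: nat}" "{fact (Suc j)..<fact (Suc j) + ?B}"] by simp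
  finally show ?thesis .
qed

text \<open>At this time the block \<open>Suc j\<close> is only about to start, so the bound is
  independent of z.\<close>

lemma card_overwrite_fact_le: "card {i. i < fact (Suc j) \<and> overwrite b g z i \<noteq> g i} \<le> 2 * fact j"
proof -
  have "{i. i < fact (Suc j) \<and> overwrite b g z i \<noteq> g i} \<subseteq> {..<2 * fact j}"
  proof
    fix i assume "i \<in> {i. i < fact (Suc j) \<and> overwrite b g z i \<noteq> g i}"
    then obtain k where k: "fact k \<le> i" "i < fact k + fact k div (z k + 1)" and i: "i < fact (Suc j)"
      by (auto simp: overwrite_def overwritten_def simp del: fact_Suc split: if_splits)
    have "k \<le> j"
    proof (rule ccontr)
      assume "\<not> k \<le> j"
      then have "fact (Suc j) \<le> (fact k :: nat)" by (intro fact_mono) simp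
      with k i show False by linarith
    qed
    then have "fact k \<le> (fact j :: nat)" by (rule fact_mono)
    moreover have "fact k div (z k + 1) \<le> fact k" by (rule div_le_dividend)
    ultimately have "i < 2 * fact j" using k by linarith
    then show "i \<in> {..<2 * fact j}" by simp
  qed
  then have "card {i. i < fact (Suc j) \<and> overwrite b g z i \<noteq> g i} \<le> card {..<2 * fact j :: nat}"
    by (intro card_mono) auto
  then show ?thesis by simp
qed

lemma overwrite_density_fact:
  "(\<lambda>j. real (card {i. i < fact (Suc j) \<and> overwrite b g z i \<noteq> g i}) / real (fact (Suc j))) \<longlonglongrightarrow> 0"
proof (rule Lim_null_comparison)
  show "(\<lambda>j. 2 / real (Suc j)) \<longlonglongrightarrow> 0" by real_asymp
  show "\<forall>\<^sub>F j in sequentially. norm (real (card {i. i < fact (Suc j) \<and> overwrite b g z i \<noteq> g i}) / real (fact (Suc j)))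
      \<le> 2 / real (Suc j)"
  proof (intro always_eventually allI)
    fix j
    have "real (card {i. i < fact (Suc j) \<and> overwrite b g z i \<noteq> g i}) \<le> real (2 * fact j)"
      using card_overwrite_fact_le of_nat_le_iff by blast
    then have "real (card {i. i < fact (Suc j) \<and> overwrite b g z i \<noteq> g i}) / real (fact (Suc j))
        \<le> real (2 * fact j) / real (fact (Suc j))"
      by (intro divide_right_mono) simp_all
    also have "\<dots> = 2 / real (Suc j)"
    proof -
      have eq: "real (fact (Suc j)) = real (Suc j) * real (fact j)"
        by (simp only: fact_Suc of_nat_mult of_nat_id)
      show ?thesis unfolding eq by (simp del: of_nat_Suc)
    qed
    finally show "norm (real (card {i. i < fact (Suc j) \<and> overwrite b g z i \<noteq> g i}) / real (fact (Suc j)))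
      \<le> 2 / real (Suc j)" by simp
  qed
qed

lemma overwrite_density:
  assumes fin: "\<And>k. finite {j. z j = k}"
  shows "(\<lambda>N. real (card {i. i < N \<and> overwrite b g z i \<noteq> g i}) / real N) \<longlonglongrightarrow> 0"
proof (rule Lim_null_comparison)
  \<comment> \<open>For positive \<open>N\<close> this places \<open>N\<close> between
    \<open>fact (Suc (lev N))\<close> and \<open>fact (Suc (Suc (lev N)))\<close>; at level 0 the
    lower bound is 1, which excludes \<open>N = 0\<close>.\<close>
  define lev where "lev N = (LEAST j. N < fact (Suc (Suc j)))" for N :: nat
  have lev_upper: "N < fact (Suc (Suc (lev N)))" for N
    unfolding lev_def
  proof (rule LeastI)
    show "N < fact (Suc (Suc N))"
      using fact_ge_self[of "Suc (Suc N)"] by linarith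
  qed
  have lev_lower: "fact (Suc (lev N)) \<le> N" if "1 \<le> N" for N
  proof (cases "lev N")
    case (Suc k)
    then have "\<not> N < fact (Suc (Suc k))"
      using not_less_Least[of k "\<lambda>j. N < fact (Suc (Suc j))"] unfolding lev_def by (simp del: fact_Suc)
    with Suc show ?thesis by (simp only: not_less)
  qed (use that in simp)
  have lim_lev: "filterlim lev at_top sequentially"
    unfolding filterlim_at_top eventually_sequentially
  proof (intro allI exI impI)
    fix Q N :: nat assume N: "fact (Suc Q) \<le> N"
    show "Q \<le> lev N"
    proof (rule ccontr)
      assume "\<not> Q \<le> lev N"
      then have "fact (Suc (Suc (lev N))) \<le> (fact (Suc Q) :: nat)" by (intro fact_mono) simp
      with N lev_upper[of N] show False by linarith
    qed
  qed
  have "filterlim (\<lambda>j. z (Suc j)) at_top sequentially"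
    unfolding filterlim_at_top
  proof
    fix K
    have "{j. z j < K} = (\<Union>k<K. {j. z j = k})" by auto
    then have "finite {j. z j < K}" using fin by simp
    then have "eventually (\<lambda>j. K \<le> z j) sequentially"
      by (simp add: cofinite_eq_sequentially[symmetric] eventually_cofinite not_le)
    then show "eventually (\<lambda>j. K \<le> z (Suc j)) sequentially"
      by (rule eventually_compose_filterlim[OF _ filterlim_Suc])
  qed
  then have "(\<lambda>j. 1 / real (Suc (z (Suc j)))) \<longlonglongrightarrow> 0"
    by (rule filterlim_compose[rotated]) real_asymp
  then have "(\<lambda>j. 2 / real (Suc j) + 1 / real (Suc (z (Suc j)))) \<longlonglongrightarrow> 0"
    by (intro tendsto_add_zero) real_asymp
  then show "(\<lambda>N. 2 / real (Suc (lev N)) + 1 / real (Suc (z (Suc (lev N))))) \<longlonglongrightarrow> 0"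
    using lim_lev by (rule filterlim_compose)
  show "\<forall>\<^sub>F N in sequentially. norm (real (card {i. i < N \<and> overwrite b g z i \<noteq> g i}) / real N)
      \<le> 2 / real (Suc (lev N)) + 1 / real (Suc (z (Suc (lev N))))"
    using eventually_ge_at_top[of 1]
  proof eventually_elim
    case (elim N)
    define j where "j = lev N"
    define F where "F = real (fact j)"
    have F: "0 < F" by (simp add: F_def)
    have "card {i. i < N \<and> overwrite b g z i \<noteq> g i} \<le> 2 * fact j + fact (Suc j) div (z (Suc j) + 1)"
      using lev_upper[of N] by (intro card_overwrite_le) (simp add: j_def del: fact_Suc)
    then have "real (card {i. i < N \<and> overwrite b g z i \<noteq> g i})
        \<le> real (2 * fact j + fact (Suc j) div (z (Suc j) + 1))"
      by (simp only: of_nat_le_iff)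
    also have "\<dots> \<le> 2 * F + real (Suc j) * F / real (Suc (z (Suc j)))"
      using of_nat_div_le_of_nat[of "fact (Suc j)" "z (Suc j) + 1", where 'a = real]
      by (simp add: F_def distrib_right)
    also have "\<dots> = (real (Suc j) * F) * (2 / real (Suc j) + 1 / real (Suc (z (Suc j))))"
      by (simp add: field_simps del: of_nat_Suc)
    also have "\<dots> \<le> real N * (2 / real (Suc j) + 1 / real (Suc (z (Suc j))))"
    proof (rule mult_right_mono)
      have "real (fact (Suc j)) \<le> real N"
        using lev_lower[OF elim] unfolding j_def of_nat_le_iff .
      moreover have "real (fact (Suc j)) = real (Suc j) * F"
        by (simp only: F_def fact_Suc of_nat_mult of_nat_id of_nat_fact)
      ultimately show "real (Suc j) * F \<le> real N" by (simp only:)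
    qed simp
    finally show ?case
      using elim by (simp add: j_def divide_le_eq ac_simps del: of_nat_Suc)
  qed
qed

text \<open>If averages converge, then so do the averages over segments that occupy a fixed fraction
  of the elapsed time, here 1/(k+2), and to the same limit. The tolerance 2 is the error in
  \<open>power_sum_coded_diff\<close> for the first power and no differing digit.\<close>

lemma limit_of_long_blocks:
  fixes P :: "nat \<Rightarrow> real"
  assumes lim: "(\<lambda>N. P N / real N) \<longlonglongrightarrow> l"
    and inf: "infinite {B. \<bar>P ((k + 2) * B) - P ((k + 1) * B) - real B * c\<bar> \<le> 2}"
  shows "l = c"
proof -
  obtain r :: "nat \<Rightarrow> nat" where r: "strict_mono r"
    "\<And>n. \<bar>P ((k + 2) * r n) - P ((k + 1) * r n) - real (r n) * c\<bar> \<le> 2"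
    using infinite_enumerate[OF inf] by auto
  have lim_r: "filterlim r at_top sequentially"
    using r(1) by (rule filterlim_subseq)
  have mult: "(\<lambda>n. real q * (P (q * r n) / real (q * r n))) \<longlonglongrightarrow> real q * l" if "0 < q" for q
  proof -
    have "filterlim (\<lambda>n. q * r n) at_top sequentially"
      using lim_r that by (intro filterlim_subseq) (use r(1) in \<open>auto simp: strict_mono_def\<close>)
    from filterlim_compose[OF lim this] show ?thesis by (intro tendsto_mult_left)
  qed
  have "(\<lambda>n. real (k + 2) * (P ((k + 2) * r n) / real ((k + 2) * r n))
      - real (k + 1) * (P ((k + 1) * r n) / real ((k + 1) * r n)) - c)
      \<longlonglongrightarrow> real (k + 2) * l - real (k + 1) * l - c"
    by (intro tendsto_diff mult tendsto_const) simp_all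
  moreover have "(\<lambda>n. real (k + 2) * (P ((k + 2) * r n) / real ((k + 2) * r n))
      - real (k + 1) * (P ((k + 1) * r n) / real ((k + 1) * r n)) - c) \<longlonglongrightarrow> 0"
  proof (rule Lim_null_comparison)
    show "(\<lambda>n. 2 * (1 / real (r n))) \<longlonglongrightarrow> 0"
      by (intro tendsto_mult_right_zero filterlim_compose[OF lim_1_over_n lim_r])
    have "\<forall>\<^sub>F n in sequentially. 1 \<le> r n"
      using lim_r by (simp add: filterlim_at_top)
    then show "\<forall>\<^sub>F n in sequentially. norm (real (k + 2) * (P ((k + 2) * r n) / real ((k + 2) * r n))
      - real (k + 1) * (P ((k + 1) * r n) / real ((k + 1) * r n)) - c) \<le> 2 * (1 / real (r n))"
    proof eventually_elim
      case (elim n)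
      have "real (k + 2) * (P ((k + 2) * r n) / real ((k + 2) * r n))
          - real (k + 1) * (P ((k + 1) * r n) / real ((k + 1) * r n)) - c
          = (P ((k + 2) * r n) - P ((k + 1) * r n) - real (r n) * c) / real (r n)"
        using elim unfolding of_nat_mult
        by (simp add: diff_divide_distrib del: of_nat_add)
      then show ?case
        using r(2)[of n] elim by (simp add: abs_divide divide_right_mono del: of_nat_add)
    qed
  qed
  ultimately have "real (k + 2) * l - real (k + 1) * l - c = 0" by (rule LIMSEQ_unique)
  then show ?thesis by (simp add: algebra_simps)
qed

text \<open>The fixed points 0 and 2/3 of the tent map; the latter is coded by \<open>0101\<dots>\<close> and
  by \<open>1010\<dots>\<close>.\<close>

lemma two_fixed_points:
  fixes m :: real
  obtains b c where "\<And>n. coded (\<lambda>i. b (n + i)) = c" and "c \<noteq> m"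
proof (cases "m = 0")
  case False
  have "binary_real (\<lambda>_. False) = 0" using binary_real_Suc[of "\<lambda>_. False"] by simp
  then show ?thesis using that[of "\<lambda>_. False" 0] False by (simp add: coded_def tent_map_def)
next
  case True
  have alt: "binary_real odd = (0 + binary_real even) / 2" "binary_real even = (1 + binary_real odd) / 2"
    using binary_real_Suc[of odd] binary_real_Suc[of even] by simp_all
  then have alt': "binary_real odd = 1/3" "binary_real even = 2/3" by simp_all
  have "coded (\<lambda>i. odd (n + i)) = 2/3" for n
  proof (cases "even n")
    case True
    then have "(\<lambda>i. odd (n + i)) = odd" by auto
    then show ?thesis using alt' by (simp add: coded_def tent_map_def)
  next
    case False
    then have "(\<lambda>i. odd (n + i)) = even" by auto
    then show ?thesis using alt' by (simp add: coded_def tent_map_def)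
  qed
  then show ?thesis using that[of odd "2/3"] True by simp
qed

context invariant_measure
begin

text \<open>Near time \<open>fact j\<close> the orbit of \<open>f z\<close> follows a fixed point during a proportion
  \<open>1 / (z j + 1)\<close> of the time elapsed, and otherwise it follows a point generic for \<open>\<mu>\<close>.\<close>

lemma reduction:
  obtains f :: "(nat \<Rightarrow> nat) \<Rightarrow> real" where "\<And>z. f z \<in> {0..1}"
    and "\<And>V z. openin (top_of_set {0..1}) V \<Longrightarrow> f z \<in> V \<Longrightarrow> \<exists>n. \<forall>z'. (\<forall>i<n. z' i = z i) \<longrightarrow> f z' \<in> V"
    and "\<And>z j. (\<And>k. finite {j. z j = k}) \<Longrightarrow> (\<lambda>N. power_sum j (f z) N / real N) \<longlonglongrightarrow> moment j"
    and "\<And>z k. infinite {j. z j = k} \<Longrightarrow> \<not> convergent (\<lambda>N. power_sum 1 (f z) N / real N)"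
proof -
  obtain g where g: "\<And>j. (\<lambda>N. power_sum j (coded g) N / real N) \<longlonglongrightarrow> moment j"
    by (rule generic_digits) blast
  obtain b c where b: "\<And>n. coded (\<lambda>i. b (n + i)) = c" and c: "c \<noteq> moment 1"
    by (rule two_fixed_points[of "moment 1"]) blast
  define f where "f z = coded (overwrite b g z)" for z
  show ?thesis
  proof (rule that[of f])
    show "f z \<in> {0..1}" for z
      unfolding f_def by (rule coded_in)
  next
    fix V z assume V: "openin (top_of_set {0..1}) V" "f z \<in> V"
    then obtain e where e: "0 < e" "\<And>x. x \<in> {0..1} \<Longrightarrow> dist x (f z) < e \<Longrightarrow> x \<in> V"
      unfolding openin_euclidean_subtopology_iff by blast
    obtain n where n: "(1/2 :: real) ^ n < e / 2"
      using real_arch_pow_inv[of "e/2" "1/2"] e(1) by auto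
    have "f z' \<in> V" if "\<forall>i<n. z' i = z i" for z'
    proof (rule e(2))
      show "f z' \<in> {0..1}" unfolding f_def by (rule coded_in)
      have "\<bar>f z' - f z\<bar> \<le> 2 * (1/2) ^ n"
        unfolding f_def using that by (intro coded_close overwrite_cong) auto
      with n show "dist (f z') (f z) < e" by (simp add: dist_real_def)
    qed
    then show "\<exists>n. \<forall>z'. (\<forall>i<n. z' i = z i) \<longrightarrow> f z' \<in> V" by blast
  next
    fix z :: "nat \<Rightarrow> nat" and j assume "\<And>k. finite {j. z j = k}"
    then show "(\<lambda>N. power_sum j (f z) N / real N) \<longlonglongrightarrow> moment j"
      unfolding f_def
      by (intro power_average_transfer[OF g, of "\<lambda>N. N"] filterlim_ident overwrite_density)
  next
    fix z :: "nat \<Rightarrow> nat" and k assume inf: "infinite {j. z j = k}"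
    let ?a = "overwrite b g z"
    show "\<not> convergent (\<lambda>N. power_sum 1 (f z) N / real N)"
    proof
      assume "convergent (\<lambda>N. power_sum 1 (f z) N / real N)"
      then obtain l where l: "(\<lambda>N. power_sum 1 (coded ?a) N / real N) \<longlonglongrightarrow> l"
        by (auto simp: convergent_def f_def)
      \<comment> \<open>Along the factorials the overwriting is invisible, so the only possible
        limit is \<open>moment 1\<close>; the blocks of length \<open>fact j div (k + 1)\<close>
        will force it to be \<open>c\<close> as well.\<close>
      have "strict_mono (\<lambda>j. fact (Suc j) :: nat)"
        by (rule strict_mono_Suc_iff[THEN iffD2]) simp
      then have fact_lim: "filterlim (\<lambda>j. fact (Suc j) :: nat) at_top sequentially"
        by (rule filterlim_subseq)
      have "(\<lambda>j. power_sum 1 (coded ?a) (fact (Suc j)) / real (fact (Suc j))) \<longlonglongrightarrow> moment 1"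
        by (rule power_average_transfer[OF g fact_lim overwrite_density_fact])
      moreover have "(\<lambda>j. power_sum 1 (coded ?a) (fact (Suc j)) / real (fact (Suc j))) \<longlonglongrightarrow> l"
        by (rule filterlim_compose[OF l fact_lim])
      ultimately have "l = moment 1" by (metis LIMSEQ_unique)
      moreover have "l = c"
      proof (rule limit_of_long_blocks[OF l])
        show "infinite {B. \<bar>power_sum 1 (coded ?a) ((k + 2) * B) - power_sum 1 (coded ?a) ((k + 1) * B) - real B * c\<bar> \<le> 2}"
          unfolding infinite_nat_iff_unbounded_le
        proof
          fix M
          \<comment> \<open>The bound on \<open>j\<close> gives both \<open>k + 1 \<le> j\<close>,
            so that \<open>k + 1\<close> divides \<open>fact j\<close>, and \<open>M \<le> B\<close>
            for the block length \<open>B\<close>.\<close>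
          obtain j where j: "z j = k" "(k + 1) * (M + 1) \<le> j"
            using inf unfolding infinite_nat_iff_unbounded_le by blast
          define B where "B = fact j div (k + 1)"
          have "(k + 1) dvd fact j"
            using j(2) by (intro dvd_fact) (auto simp: algebra_simps)
          then have B: "fact j = (k + 1) * B" by (simp only: B_def dvd_mult_div_cancel)
          have "(k + 1) * (M + 1) \<le> (k + 1) * B"
            using j(2) fact_ge_self[of j] unfolding B[symmetric] by linarith
          then have "M \<le> B" by (simp only: mult_le_cancel1) simp
          have "{i. i < B \<and> ?a (fact j + i) \<noteq> b (fact j + i)} = {}"
          proof -
            have "fact j + i \<in> overwritten z" if "i < B" for i
              unfolding overwritten_def using j(1) that by (auto simp: B_def intro!: exI[of _ j])
            then show ?thesis by (auto simp: overwrite_def)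
          qed
          then have "\<bar>power_sum 1 (coded (\<lambda>i. ?a (fact j + i))) B - power_sum 1 (coded (\<lambda>i. b (fact j + i))) B\<bar> \<le> 2"
            using power_sum_coded_diff[of 1 "\<lambda>i. ?a (fact j + i)" B "\<lambda>i. b (fact j + i)"]
            by (simp only: card.empty of_nat_0 add_0 mult_1_right of_nat_1)
          moreover have "power_sum 1 (coded (\<lambda>i. b (fact j + i))) B = real B * c"
            using b[of "fact j + _"] by (simp add: power_sum_coded add.assoc)
          moreover have "power_sum 1 (coded ?a) ((k + 2) * B)
              = power_sum 1 (coded ?a) ((k + 1) * B) + power_sum 1 (coded (\<lambda>i. ?a (fact j + i))) B"
          proof -
            have "(k + 2) * B = fact j + B" by (simp add: B algebra_simps)
            then show ?thesis by (simp only: power_sum_coded_add B)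
          qed
          ultimately have "\<bar>power_sum 1 (coded ?a) ((k + 2) * B) - power_sum 1 (coded ?a) ((k + 1) * B) - real B * c\<bar> \<le> 2"
            by simp
          with \<open>M \<le> B\<close> show "\<exists>n\<ge>M. n \<in> {B. \<bar>power_sum 1 (coded ?a) ((k + 2) * B) - power_sum 1 (coded ?a) ((k + 1) * B) - real B * c\<bar> \<le> 2}"
            by blast
        qed
      qed
      ultimately show False using c by simp
    qed
  qed
qed

end

section \<open>Generic points and moments\<close>

text \<open>A retraction of the line onto the unit interval. It transports intervals and continuous
  functions to the whole line, where weak convergence is formulated.\<close>

definition clamp01 :: "real \<Rightarrow> real" where
  "clamp01 x = max 0 (min 1 x)"

lemma clamp01_in: "clamp01 x \<in> {0..1}"
  by (simp add: clamp01_def)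

lemma clamp01_eq: "x \<in> {0..1} \<Longrightarrow> clamp01 x = x"
  by (simp add: clamp01_def)

lemma continuous_on_clamp01: "continuous_on UNIV clamp01"
  unfolding clamp01_def[abs_def] by (intro continuous_intros)

lemma is_interval_clamp01_vimage:
  assumes "is_interval I"
  shows "is_interval (clamp01 -` I)"
  unfolding is_interval_1
proof (intro allI impI ballI)
  fix a b x assume "a \<in> clamp01 -` I" "b \<in> clamp01 -` I" and x: "a \<le> x \<and> x \<le> b"
  then have "clamp01 a \<in> I" "clamp01 b \<in> I" by simp_all
  moreover have "clamp01 a \<le> clamp01 x" "clamp01 x \<le> clamp01 b"
    using x by (auto simp: clamp01_def)
  ultimately have "clamp01 x \<in> I" using assms unfolding is_interval_1 by blast
  then show "x \<in> clamp01 -` I" by simp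
qed

text \<open>By continuity, the preimages of the relative closure and the relative interior are
  closed and open on the line.\<close>

lemma frontier_clamp01_vimage:
  assumes I: "I \<subseteq> {0..1}"
  shows "frontier (clamp01 -` I) \<subseteq> clamp01 -` (top_of_set {0..1} frontier_of I)"
proof -
  let ?X = "top_of_set {0..1 :: real}"
  have cont: "continuous_map euclidean ?X clamp01"
    using continuous_on_clamp01 clamp01_in by (simp add: continuous_map_in_subtopology image_subset_iff)
  have "closedin euclidean {x \<in> topspace euclidean. clamp01 x \<in> ?X closure_of I}"
    using cont closedin_closure_of by (rule closedin_continuous_map_preimage)
  then have "closed (clamp01 -` (?X closure_of I))"
    by (simp add: vimage_def)
  moreover have "I \<subseteq> ?X closure_of I"
    using I by (intro closure_of_subset) simp
  ultimately have clos: "closure (clamp01 -` I) \<subseteq> clamp01 -` (?X closure_of I)"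
    by (intro closure_minimal) auto
  have "openin euclidean {x \<in> topspace euclidean. clamp01 x \<in> ?X interior_of I}"
    using cont openin_interior_of by (rule openin_continuous_map_preimage)
  then have "open (clamp01 -` (?X interior_of I))"
    by (simp add: vimage_def)
  moreover have "?X interior_of I \<subseteq> I" by (rule interior_of_subset)
  ultimately have int: "clamp01 -` (?X interior_of I) \<subseteq> interior (clamp01 -` I)"
    by (intro interior_maximal) auto
  from clos int show ?thesis
    by (auto simp: frontier_def frontier_of_def)
qed

text \<open>The uniform distribution on an initial orbit segment. \<open>Suc N\<close> keeps the
  segment nonempty; the shift of index does not affect limits.\<close>

definition empirical :: "real \<Rightarrow> nat \<Rightarrow> real measure" where
  "empirical x N = distr (measure_pmf (pmf_of_set {..<Suc N})) borel (\<lambda>n. (tent_map ^^ n) x)"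

lemma real_distribution_empirical: "real_distribution (empirical x N)"
  unfolding empirical_def by (rule prob_space.real_distribution_distr[OF prob_space_measure_pmf]) simp

lemma measure_empirical:
  assumes "A \<in> sets borel"
  shows "measure (empirical x N) A = visit_freq tent_map x A (Suc N)"
proof -
  have "{..<Suc N} \<inter> ((\<lambda>n. (tent_map ^^ n) x) -` A) = {n. n < Suc N \<and> (tent_map ^^ n) x \<in> A}"
    by auto
  then show ?thesis
    using assms unfolding empirical_def visit_freq_def
    by (subst measure_distr) (simp_all add: measure_pmf_of_set lessThan_empty_iff)
qed

lemma integral_empirical:
  fixes f :: "real \<Rightarrow> real"
  assumes "f \<in> borel_measurable borel"
  shows "integral\<^sup>L (empirical x N) f = (\<Sum>n<Suc N. f ((tent_map ^^ n) x)) / real (Suc N)"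
  using assms unfolding empirical_def
  by (subst integral_distr) (simp_all add: integral_pmf_of_set lessThan_empty_iff)

section \<open>Weak convergence of the empirical measures\<close>

context invariant_measure
begin

lemma id_measurable: "(\<lambda>x. x) \<in> borel_measurable \<mu>"
  by (rule measurable_from_borel) simp_all

definition extension :: "real measure" where
  "extension = distr \<mu> borel (\<lambda>x. x)"

lemma real_distribution_extension: "real_distribution extension"
  unfolding extension_def using id_measurable by (rule real_distribution_distr)

lemma measure_extension:
  assumes "A \<in> sets borel"
  shows "measure extension A = measure \<mu> (A \<inter> {0..1})"
proof -
  from measure_distr[OF id_measurable assms] show ?thesis
    by (simp add: extension_def space_eq vimage_ident)
qed

lemma integral_extension:
  fixes f :: "real \<Rightarrow> real"
  assumes "f \<in> borel_measurable borel"
  shows "integral\<^sup>L extension f = integral\<^sup>L \<mu> f"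
  unfolding extension_def using id_measurable assms by (rule integral_distr)

text \<open>By Weierstrass, \<open>f\<close> is within \<open>e / 3\<close> of a polynomial, whose
  orbit averages converge by linearity; the replacement costs \<open>e / 3\<close> in the averages
  and \<open>e / 3\<close> in the integral.\<close>

lemma average_continuous:
  fixes f :: "real \<Rightarrow> real"
  assumes x: "x \<in> {0..1}"
    and lim: "\<And>j. (\<lambda>N. power_sum j x N / real N) \<longlonglongrightarrow> moment j"
    and f: "continuous_on {0..1} f" "f \<in> borel_measurable borel"
  shows "(\<lambda>N. (\<Sum>n<N. f ((tent_map ^^ n) x)) / real N) \<longlonglongrightarrow> integral\<^sup>L \<mu> f"
proof (rule tendstoI)
  fix e :: real assume e: "0 < e"
  obtain g where g: "real_polynomial_function g" "\<And>y. y \<in> {0..1} \<Longrightarrow> \<bar>f y - g y\<bar> < e / 3"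
    using Stone_Weierstrass_real_polynomial_function[of "{0..1::real}" f "e/3"] f(1) e by auto
  obtain c d where c: "g = (\<lambda>y. \<Sum>i\<le>d. c i * y ^ i)"
    using g(1) unfolding real_polynomial_function_iff_sum by blast
  have int_pow: "integrable \<mu> (\<lambda>y. y ^ i)" for i
    using integrable_power[of 0 i] by simp
  have int_g: "integrable \<mu> g"
    unfolding c by (intro Bochner_Integration.integrable_sum integrable_mult_right int_pow)
  have g_integral: "integral\<^sup>L \<mu> g = (\<Sum>i\<le>d. c i * moment i)"
    unfolding c moment_def
    by (subst Bochner_Integration.integral_sum) (auto intro: integrable_mult_right int_pow)
  have g_avg: "(\<Sum>n<N. g ((tent_map ^^ n) x)) / real N = (\<Sum>i\<le>d. c i * (power_sum i x N / real N))" for N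
  proof -
    have "(\<Sum>n<N. g ((tent_map ^^ n) x)) = (\<Sum>i\<le>d. c i * power_sum i x N)"
      unfolding c power_sum_def sum_distrib_left by (rule sum.swap)
    then show ?thesis by (simp add: sum_divide_distrib)
  qed
  have g_lim: "(\<lambda>N. (\<Sum>n<N. g ((tent_map ^^ n) x)) / real N) \<longlonglongrightarrow> integral\<^sup>L \<mu> g"
    unfolding g_avg g_integral by (intro tendsto_sum tendsto_mult_left lim)
  have "integrable \<mu> (\<lambda>y. f y - g y)"
  proof (rule integrable_const_bound[of _ "e/3"])
    show "AE y in \<mu>. norm (f y - g y) \<le> e / 3"
      using g(2) by (intro AE_I2) (auto simp: space_eq intro: less_imp_le)
    show "(\<lambda>y. f y - g y) \<in> borel_measurable \<mu>"
      using measurable_from_borel[OF _ f(2)] borel_measurable_integrable[OF int_g]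
      by (intro borel_measurable_diff) simp_all
  qed
  then have int_f: "integrable \<mu> f"
    using Bochner_Integration.integrable_add[OF _ int_g, of "\<lambda>y. f y - g y"] by simp
  have "\<bar>integral\<^sup>L \<mu> f - integral\<^sup>L \<mu> g\<bar> \<le> e / 3"
  proof -
    have "norm (integral\<^sup>L \<mu> (\<lambda>y. f y - g y)) \<le> integral\<^sup>L \<mu> (\<lambda>y. norm (f y - g y))"
      by (rule integral_norm_bound)
    also have "\<dots> \<le> e / 3"
      using g(2) int_f int_g
      by (intro integral_le_const AE_I2 integrable_norm Bochner_Integration.integrable_diff)
        (auto simp: space_eq intro: less_imp_le)
    finally show ?thesis using int_f int_g by (simp add: Bochner_Integration.integral_diff)
  qed
  moreover have "\<bar>(\<Sum>n<N. f ((tent_map ^^ n) x)) / real N - (\<Sum>n<N. g ((tent_map ^^ n) x)) / real N\<bar> \<le> e / 3" for N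
  proof (cases "N = 0")
    case False
    have "\<bar>\<Sum>n<N. f ((tent_map ^^ n) x) - g ((tent_map ^^ n) x)\<bar> \<le> (\<Sum>n<N. e / 3)"
      using g(2)[OF tent_map_funpow_in[OF x]] by (intro sum_abs[THEN order_trans] sum_mono) (auto intro: less_imp_le)
    then have "\<bar>\<Sum>n<N. f ((tent_map ^^ n) x) - g ((tent_map ^^ n) x)\<bar> / real N \<le> e / 3"
      using False by (simp add: divide_le_eq mult.commute)
    then show ?thesis
      by (simp add: sum_subtractf diff_divide_distrib[symmetric] abs_divide)
  qed (use e in simp)
  moreover from g_lim e
  have "\<forall>\<^sub>F N in sequentially. dist ((\<Sum>n<N. g ((tent_map ^^ n) x)) / real N) (integral\<^sup>L \<mu> g) < e / 3"
    by (intro tendstoD) simp_all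
  ultimately show "\<forall>\<^sub>F N in sequentially. dist ((\<Sum>n<N. f ((tent_map ^^ n) x)) / real N) (integral\<^sup>L \<mu> f) < e"
  proof (elim eventually_mono)
    fix N
    let ?f = "(\<Sum>n<N. f ((tent_map ^^ n) x)) / real N" and ?g = "(\<Sum>n<N. g ((tent_map ^^ n) x)) / real N"
    assume "dist ?g (integral\<^sup>L \<mu> g) < e / 3" "\<bar>integral\<^sup>L \<mu> f - integral\<^sup>L \<mu> g\<bar> \<le> e / 3"
      "\<And>N. \<bar>(\<Sum>n<N. f ((tent_map ^^ n) x)) / real N - (\<Sum>n<N. g ((tent_map ^^ n) x)) / real N\<bar> \<le> e / 3"
    note this(1,2) this(3)[of N]
    then show "dist ?f (integral\<^sup>L \<mu> f) < e"
      unfolding dist_real_def by linarith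
  qed
qed

lemma moments_imp_weak_conv:
  assumes "x \<in> {0..1}" and "\<And>j. (\<lambda>N. power_sum j x N / real N) \<longlonglongrightarrow> moment j"
  shows "weak_conv_m (empirical x) extension"
proof (rule integral_cts_step_conv_imp_weak_conv[OF real_distribution_empirical real_distribution_extension])
  fix a b :: real assume "a < b"
  then have "continuous_on UNIV (cts_step a b)"
    by (intro uniformly_continuous_imp_continuous cts_step_uniformly_continuous)
  then have "continuous_on {0..1} (cts_step a b)" and m: "cts_step a b \<in> borel_measurable borel"
    by (auto intro: continuous_on_subset borel_measurable_continuous_onI)
  from average_continuous[OF assms this, THEN LIMSEQ_Suc]
  show "(\<lambda>N. integral\<^sup>L (empirical x N) (cts_step a b)) \<longlonglongrightarrow> integral\<^sup>L extension (cts_step a b)"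
    by (simp only: integral_empirical[OF m] integral_extension[OF m])
qed

lemma weak_conv_imp_moments:
  assumes x: "x \<in> {0..1}" and conv: "weak_conv_m (empirical x) extension"
  shows "(\<lambda>N. power_sum j x N / real N) \<longlonglongrightarrow> moment j"
proof -
  \<comment> \<open>Powers are unbounded on the line; clamping makes them bounded test functions
    without changing them on the orbit or on the space of \<mu>.\<close>
  let ?f = "\<lambda>y. clamp01 y ^ j"
  have cont: "continuous_on UNIV ?f"
    by (intro continuous_intros continuous_on_clamp01)
  then have m: "?f \<in> borel_measurable borel" by (rule borel_measurable_continuous_onI)
  have "(\<lambda>N. integral\<^sup>L (empirical x N) ?f) \<longlonglongrightarrow> integral\<^sup>L extension ?f"
  proof (rule weak_conv_imp_integral_bdd_continuous_conv
      [OF real_distribution_empirical real_distribution_extension conv])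
    show "isCont ?f y" for y using cont by (simp add: continuous_on_eq_continuous_at)
    show "norm (?f y) \<le> 1" for y using clamp01_in[of y] by (simp add: power_le_one)
  qed
  moreover have "integral\<^sup>L extension ?f = moment j"
    unfolding integral_extension[OF m] moment_def
    by (intro Bochner_Integration.integral_cong) (auto simp: space_eq clamp01_eq)
  moreover have "integral\<^sup>L (empirical x N) ?f = power_sum j x (Suc N) / real (Suc N)" for N
    unfolding integral_empirical[OF m] power_sum_def
    by (simp only: clamp01_eq[OF tent_map_funpow_in[OF x]])
  ultimately have "(\<lambda>N. power_sum j x (Suc N) / real (Suc N)) \<longlonglongrightarrow> moment j" by simp
  then show ?thesis by (rule LIMSEQ_imp_Suc)
qed

text \<open>The portmanteau theorem is applied to the pullback of \<open>I\<close> rather than to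
  \<open>I\<close>, because \<open>generates\<close> uses the frontier relative to the unit
  interval. For instance, the whole interval has empty relative frontier, while on the line its
  frontier contains 0, which may be an atom.\<close>

lemma weak_conv_imp_generates:
  assumes x: "x \<in> {0..1}" and conv: "weak_conv_m (empirical x) extension"
  shows "generates tent_map \<mu> x"
  unfolding generates_def
proof (intro allI impI, elim conjE)
  fix I :: "real set"
  assume I: "is_interval I" "I \<subseteq> {0..1}" "measure \<mu> (top_of_set {0..1} frontier_of I) = 0"
  let ?A = "clamp01 -` I"
  have A: "?A \<in> sets borel"
    using is_interval_clamp01_vimage[OF I(1)] by (rule real_interval_borel_measurable)
  have "measure extension (frontier ?A) = 0"
  proof -
    have fr: "top_of_set {0..1} frontier_of I \<in> sets \<mu>"
    proof -
      have "closedin (top_of_set {0..1}) (top_of_set {0..1} frontier_of I)"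
        by (rule closedin_frontier_of)
      then have "closed (top_of_set {0..1} frontier_of I)"
        by (rule closedin_closed_trans) simp
      then show ?thesis
        unfolding sets_eq sets_restrict_space
        using frontier_of_subset_topspace[of "top_of_set {0..1}" I] by (auto intro!: image_eqI borel_closed)
    qed
    have "frontier ?A \<inter> {0..1} \<subseteq> top_of_set {0..1} frontier_of I"
      using frontier_clamp01_vimage[OF I(2)] by (auto simp: clamp01_eq subset_iff)
    then have "measure \<mu> (frontier ?A \<inter> {0..1}) \<le> measure \<mu> (top_of_set {0..1} frontier_of I)"
      using fr by (rule finite_measure_mono)
    with I(3) have "measure \<mu> (frontier ?A \<inter> {0..1}) = 0"
      using measure_nonneg[of \<mu> "frontier ?A \<inter> {0..1}"] by linarith
    then show ?thesis by (subst measure_extension) auto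
  qed
  then have "emeasure extension (frontier ?A) = 0"
    using real_distribution_extension
    by (simp add: real_distribution_def prob_space_def finite_measure.emeasure_eq_measure)
  from weak_conv_imp_continuity_set_conv[OF real_distribution_empirical real_distribution_extension conv A this]
  have "(\<lambda>N. visit_freq tent_map x ?A (Suc N)) \<longlonglongrightarrow> measure \<mu> (?A \<inter> {0..1})"
    by (simp only: measure_empirical[OF A] measure_extension[OF A])
  moreover have "visit_freq tent_map x ?A = visit_freq tent_map x I"
    using tent_map_funpow_in[OF x] by (simp add: visit_freq_def[abs_def] clamp01_eq)
  moreover have "?A \<inter> {0..1} = I"
    using I(2) by (auto simp: clamp01_eq subset_iff)
  ultimately have "(\<lambda>N. visit_freq tent_map x I (Suc N)) \<longlonglongrightarrow> measure \<mu> I" by simp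
  then show "visit_freq tent_map x I \<longlonglongrightarrow> measure \<mu> I" by (rule LIMSEQ_imp_Suc)
qed

text \<open>Testing the intervals of points up to \<open>a\<close> suffices: their relative frontier
  is at most the point \<open>a\<close>, which is null where the distribution function is
  continuous.\<close>

lemma generates_imp_weak_conv:
  assumes x: "x \<in> {0..1}" and gen: "generates tent_map \<mu> x"
  shows "weak_conv_m (empirical x) extension"
  unfolding weak_conv_m_def weak_conv_def
proof (intro allI impI)
  fix a assume "isCont (cdf extension) a"
  then have "measure extension {a} = 0"
    using finite_borel_measure.isCont_cdf[OF real_distribution.finite_borel_measure_M[OF real_distribution_extension]]
    by blast
  then have a: "measure \<mu> ({a} \<inter> {0..1}) = 0"
    using measure_extension[of "{a}"] by simp
  define I where "I = {..a} \<inter> {0..1}"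
  have "is_interval I"
    unfolding I_def by (intro is_interval_Int is_interval_ic is_interval_cc)
  moreover have "I \<subseteq> {0..1}" by (simp add: I_def)
  moreover have "measure \<mu> (top_of_set {0..1} frontier_of I) = 0"
  proof -
    have "top_of_set {0..1} frontier_of I \<subseteq> {a} \<inter> {0..1}"
    proof -
      have "closedin (top_of_set {0..1}) I"
        unfolding I_def closedin_closed by (intro exI[of _ "{..a}"] conjI closed_atMost Int_commute)
      then have "top_of_set {0..1} closure_of I = I" by (rule closure_of_closedin)
      moreover have "openin (top_of_set {0..1}) ({..<a} \<inter> {0..1})"
        unfolding openin_open by (intro exI[of _ "{..<a}"] conjI open_lessThan Int_commute)
      then have "{..<a} \<inter> {0..1} \<subseteq> top_of_set {0..1} interior_of I"
        by (rule interior_of_maximal[rotated]) (auto simp: I_def)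
      ultimately have "top_of_set {0..1} frontier_of I \<subseteq> I - ({..<a} \<inter> {0..1})"
        unfolding frontier_of_def by blast
      then show ?thesis by (force simp: I_def)
    qed
    moreover have "{a} \<inter> {0..1} \<in> sets \<mu>"
      unfolding sets_eq sets_restrict_space by (intro image_eqI[of _ _ "{a}"] Int_commute) simp
    ultimately have "measure \<mu> (top_of_set {0..1} frontier_of I) \<le> measure \<mu> ({a} \<inter> {0..1})"
      by (rule finite_measure_mono)
    with a show ?thesis
      using measure_nonneg[of \<mu> "top_of_set {0..1} frontier_of I"] by linarith
  qed
  ultimately have "visit_freq tent_map x I \<longlonglongrightarrow> measure \<mu> I"
    using gen unfolding generates_def by blast
  then have "(\<lambda>N. visit_freq tent_map x I (Suc N)) \<longlonglongrightarrow> measure \<mu> I" by (rule LIMSEQ_Suc)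
  moreover have "visit_freq tent_map x I = visit_freq tent_map x {..a}"
    using tent_map_funpow_in[OF x] by (simp add: visit_freq_def[abs_def] I_def)
  ultimately show "(\<lambda>N. cdf (empirical x N) a) \<longlonglongrightarrow> cdf extension a"
    by (simp add: cdf_def measure_empirical measure_extension I_def)
qed

theorem generates_iff:
  assumes "x \<in> {0..1}"
  shows "generates tent_map \<mu> x \<longleftrightarrow> (\<forall>j. (\<lambda>N. power_sum j x N / real N) \<longlonglongrightarrow> moment j)"
  using generates_imp_weak_conv[OF assms] weak_conv_imp_moments[OF assms]
    moments_imp_weak_conv[OF assms] weak_conv_imp_generates[OF assms] by blast

end

section \<open>Complexity of the basin and of the irregular points\<close>

text \<open>The strict inequality makes the condition for each \<open>M\<close> open. The index sets
  \<open>P M\<close> cover both late times and pairs of late times.\<close>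

lemma gdelta_in_frequently_greater:
  fixes g :: "'i::countable \<Rightarrow> 'a::topological_space \<Rightarrow> real" and P :: "nat \<Rightarrow> 'i set"
  assumes "\<And>p. continuous_on S (g p)"
  shows "gdelta_in (top_of_set S) {x \<in> S. \<forall>M. \<exists>p\<in>P M. c < g p x}"
proof -
  have op: "openin (top_of_set S) (\<Union>p\<in>P M. {x \<in> S. c < g p x})" for M
  proof (rule openin_Union)
    fix U assume "U \<in> (\<lambda>p. {x \<in> S. c < g p x}) ` P M"
    then obtain p where "U = S \<inter> g p -` {c<..}" by auto
    then show "openin (top_of_set S) U"
      using continuous_openin_preimage_gen[OF assms[of p] open_greaterThan] by simp
  qed
  have "gdelta_in (top_of_set S) (\<Inter>M. \<Union>p\<in>P M. {x \<in> S. c < g p x})"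
  proof (rule gdelta_in_Inter)
    show "countable (range (\<lambda>M. \<Union>p\<in>P M. {x \<in> S. c < g p x}))" by simp
    show "gdelta_in (top_of_set S) U" if "U \<in> range (\<lambda>M. \<Union>p\<in>P M. {x \<in> S. c < g p x})" for U
      using that op by (auto intro: open_imp_gdelta_in)
  qed simp
  also have "(\<Inter>M. \<Union>p\<in>P M. {x \<in> S. c < g p x}) = {x \<in> S. \<forall>M. \<exists>p\<in>P M. c < g p x}"
    by auto
  finally show ?thesis .
qed

lemma continuous_on_tent_map: "continuous_on UNIV tent_map"
proof -
  have "tent_map = (\<lambda>x. 1 - \<bar>2 * x - 1\<bar>)"
    by (auto simp: tent_map_def fun_eq_iff abs_if)
  moreover have "continuous_on UNIV (\<lambda>x :: real. 1 - \<bar>2 * x - 1\<bar>)"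
    by (intro continuous_intros)
  ultimately show ?thesis by (simp only:)
qed

lemma continuous_on_funpow_tent_map: "continuous_on S (tent_map ^^ n)"
proof (rule continuous_on_subset)
  show "continuous_on UNIV (tent_map ^^ n)"
    by (induction n)
      (simp_all add: continuous_on_compose2[OF continuous_on_tent_map] comp_def id_def)
qed simp

lemma continuous_on_power_sum: "continuous_on S (\<lambda>x. power_sum j x N)"
  unfolding power_sum_def by (intro continuous_intros continuous_on_funpow_tent_map)

lemma not_tendsto_iff_frequently:
  fixes X :: "nat \<Rightarrow> real"
  shows "\<not> X \<longlonglongrightarrow> l \<longleftrightarrow> (\<exists>k::nat. \<forall>M. \<exists>N\<in>{M..}. 1 / real (Suc k) < \<bar>X N - l\<bar>)"
proof
  assume "\<not> X \<longlonglongrightarrow> l"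
  then obtain e where e: "0 < e" "\<forall>M. \<exists>N\<ge>M. e \<le> \<bar>X N - l\<bar>"
    by (auto simp: lim_sequentially dist_real_def not_less)
  obtain k where "inverse (real (Suc k)) < e" using reals_Archimedean[OF e(1)] by blast
  with e(2) show "\<exists>k::nat. \<forall>M. \<exists>N\<in>{M..}. 1 / real (Suc k) < \<bar>X N - l\<bar>"
    by (intro exI[of _ k]) (force simp: inverse_eq_divide)
next
  assume "\<exists>k::nat. \<forall>M. \<exists>N\<in>{M..}. 1 / real (Suc k) < \<bar>X N - l\<bar>"
  then obtain k :: nat where k: "\<And>M. \<exists>N\<in>{M..}. 1 / real (Suc k) < \<bar>X N - l\<bar>" by blast
  show "\<not> X \<longlonglongrightarrow> l"
  proof
    assume "X \<longlonglongrightarrow> l"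
    then obtain M where "\<forall>N\<ge>M. \<bar>X N - l\<bar> < 1 / real (Suc k)"
      unfolding lim_sequentially dist_real_def by (metis of_nat_0_less_iff zero_less_Suc zero_less_divide_1_iff)
    with k[of M] show False by force
  qed
qed

text \<open>No limit is given here, and a quantifier over candidate limits would be uncountable; the
  Cauchy criterion replaces it by one over pairs of late times.\<close>

lemma not_convergent_iff_frequently:
  fixes X :: "nat \<Rightarrow> real"
  shows "\<not> convergent X \<longleftrightarrow> (\<exists>k::nat. \<forall>M. \<exists>p\<in>{M..} \<times> {M..}. 1 / real (Suc k) < \<bar>X (fst p) - X (snd p)\<bar>)"
  unfolding Cauchy_convergent_iff[symmetric]
proof
  assume "\<not> Cauchy X"
  then obtain e where e: "0 < e" "\<forall>M. \<exists>m\<ge>M. \<exists>n\<ge>M. e \<le> \<bar>X m - X n\<bar>"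
    by (auto simp: Cauchy_def dist_real_def not_less)
  obtain k where "inverse (real (Suc k)) < e" using reals_Archimedean[OF e(1)] by blast
  with e(2) show "\<exists>k::nat. \<forall>M. \<exists>p\<in>{M..} \<times> {M..}. 1 / real (Suc k) < \<bar>X (fst p) - X (snd p)\<bar>"
    by (intro exI[of _ k]) (force simp: inverse_eq_divide)
next
  assume "\<exists>k::nat. \<forall>M. \<exists>p\<in>{M..} \<times> {M..}. 1 / real (Suc k) < \<bar>X (fst p) - X (snd p)\<bar>"
  then obtain k :: nat where k: "\<And>M. \<exists>p\<in>{M..} \<times> {M..}. 1 / real (Suc k) < \<bar>X (fst p) - X (snd p)\<bar>" by blast
  show "\<not> Cauchy X"
  proof
    assume "Cauchy X"
    then obtain M where "\<forall>m\<ge>M. \<forall>n\<ge>M. \<bar>X m - X n\<bar> < 1 / real (Suc k)"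
      unfolding Cauchy_def dist_real_def by (metis of_nat_0_less_iff zero_less_Suc zero_less_divide_1_iff)
    with k[of M] show False by force
  qed
qed

section \<open>Complexity of the basin\<close>

context invariant_measure
begin

lemma Pi0_3_basin: "Pi0 (top_of_set {0..1}) 3 (basin tent_map \<mu>)"
proof -
  let ?G = "\<lambda>(j, k :: nat). {x \<in> {0..1}. \<forall>M. \<exists>N\<in>{M..}. 1 / real (Suc k) < \<bar>power_sum j x N / real N - moment j\<bar>}"
  have "Sigma0 (top_of_set {0..1}) 3 (\<Union>i\<in>UNIV. ?G i)"
  proof (rule Sigma0_3_UN)
    fix i :: "nat \<times> nat"
    obtain j k where "i = (j, k)" by (cases i)
    moreover have "continuous_on {0..1} (\<lambda>x. \<bar>power_sum j x N / real N - moment j\<bar>)" for N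
      unfolding divide_inverse by (intro continuous_intros continuous_on_power_sum)
    ultimately show "gdelta_in (top_of_set {0..1}) (?G i)"
      using gdelta_in_frequently_greater[of "{0..1}" "\<lambda>N x. \<bar>power_sum j x N / real N - moment j\<bar>"]
      by simp
  qed simp
  also have "(\<Union>i\<in>UNIV. ?G i) = {0..1} - basin tent_map \<mu>"
    using generates_iff not_tendsto_iff_frequently[of "\<lambda>N. power_sum _ _ N / real N" "moment _"]
    by (fastforce simp: basin_def)
  finally show ?thesis by (auto simp: Pi0_def basin_def)
qed

lemma not_Sigma0_3_basin: "\<not> Sigma0 (top_of_set {0..1}) 3 (basin tent_map \<mu>)"
proof -
  obtain f :: "(nat \<Rightarrow> nat) \<Rightarrow> real" where f: "\<And>z. f z \<in> {0..1}"
    "\<And>V z. openin (top_of_set {0..1}) V \<Longrightarrow> f z \<in> V \<Longrightarrow> \<exists>n. \<forall>z'. (\<forall>i<n. z' i = z i) \<longrightarrow> f z' \<in> V"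
    "\<And>z j. (\<And>k. finite {j. z j = k}) \<Longrightarrow> (\<lambda>N. power_sum j (f z) N / real N) \<longlonglongrightarrow> moment j"
    "\<And>z k. infinite {j. z j = k} \<Longrightarrow> \<not> convergent (\<lambda>N. power_sum 1 (f z) N / real N)"
    by (rule reduction) blast
  show ?thesis
  proof (rule not_Sigma0_3[of _ f, OF f(2)])
    fix z
    have "f z \<in> basin tent_map \<mu> \<longleftrightarrow> (\<forall>j. (\<lambda>N. power_sum j (f z) N / real N) \<longlonglongrightarrow> moment j)"
      using f(1)[of z] generates_iff[OF f(1)[of z]] by (simp add: basin_def)
    also have "\<dots> \<longleftrightarrow> (\<forall>k. finite {j. z j = k})"
      using f(3)[of z] f(4)[of z] by (meson convergent_def)
    finally show "f z \<in> basin tent_map \<mu> \<longleftrightarrow> (\<forall>k. finite {j. z j = k})" .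
  qed
qed

end

section \<open>Frequencies of visits to cylinders\<close>

lemma average_eventually_const:
  fixes a :: "nat \<Rightarrow> real"
  assumes "\<And>n. K \<le> n \<Longrightarrow> a n = c"
  shows "(\<lambda>N. (\<Sum>n<N. a n) / real N) \<longlonglongrightarrow> c"
proof (rule Lim_transform_eventually)
  let ?C = "\<Sum>n<K. a n - c"
  have "(\<lambda>N. ?C * (1 / real N) + c) \<longlonglongrightarrow> ?C * 0 + c"
    by (intro tendsto_intros lim_1_over_n)
  then show "(\<lambda>N. ?C * (1 / real N) + c) \<longlonglongrightarrow> c" by simp
  show "\<forall>\<^sub>F N in sequentially. ?C * (1 / real N) + c = (\<Sum>n<N. a n) / real N"
    using eventually_ge_at_top[of "Suc K"]
  proof eventually_elim
    case (elim N)
    have "(\<Sum>n<N. a n - c) = ?C"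
      using elim assms by (intro sum.mono_neutral_right) auto
    then have "(\<Sum>n<N. a n) = ?C + real N * c" by (simp add: sum_subtractf)
    with elim show ?case by (simp add: field_simps)
  qed
qed

lemma visit_freq_eq_sum: "visit_freq T x A N = (\<Sum>n<N. indicator A ((T ^^ n) x)) / real N"
proof -
  have "{..<N} \<inter> {n. (T ^^ n) x \<in> A} = {n. n < N \<and> (T ^^ n) x \<in> A}" by auto
  then show ?thesis
    by (simp add: visit_freq_def indicator_def of_bool_def[symmetric] sum.If_cases flip: of_bool_def)
qed

text \<open>The points whose orbit reaches 1, and is then absorbed by the fixed point 0. Every other
  orbit also avoids 1/2, so that visits to cylinders depend on the point continuously.\<close>

definition absorbed :: "real set" where
  "absorbed = {x \<in> {0..1}. \<exists>n. (tent_map ^^ n) x = 1}"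

lemma absorbed_orbit:
  assumes "x \<in> absorbed"
  obtains K where "\<And>n. K \<le> n \<Longrightarrow> (tent_map ^^ n) x = 0"
proof -
  obtain m where m: "(tent_map ^^ m) x = 1" using assms by (auto simp: absorbed_def)
  have "(tent_map ^^ n) x = 0" if "Suc m \<le> n" for n
    using that
  proof (induction n rule: dec_induct)
    case base
    have "tent_map 1 = 0" by (simp add: tent_map_def)
    with m show ?case by simp
  next
    case (step n)
    have "tent_map 0 = 0" by (simp add: tent_map_def)
    with step show ?case by simp
  qed
  then show ?thesis by (rule that)
qed

lemma not_absorbed_orbit:
  assumes "x \<in> {0..1} - absorbed"
  shows "(tent_map ^^ n) x \<in> {0..<1}" "(tent_map ^^ n) x \<noteq> 1/2"
proof -
  have ne1: "(tent_map ^^ n) x \<noteq> 1" for n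
    using assms by (auto simp: absorbed_def)
  then show "(tent_map ^^ n) x \<in> {0..<1}"
    using tent_map_funpow_in[of x n] assms by (auto simp: less_le)
  show "(tent_map ^^ n) x \<noteq> 1/2"
    using ne1[of "Suc n"] by (auto simp: tent_map_def)
qed

lemma gdelta_in_not_absorbed: "gdelta_in (top_of_set {0..1}) ({0..1} - absorbed)"
proof -
  have cl: "closedin (top_of_set {0..1}) {x \<in> {0..1}. (tent_map ^^ n) x = 1}" for n
    by (rule continuous_closedin_preimage_constant[OF continuous_on_funpow_tent_map])
  have "absorbed = (\<Union>n. {x \<in> {0..1}. (tent_map ^^ n) x = 1})"
    by (auto simp: absorbed_def)
  moreover have "fsigma_in (top_of_set {0..1}) (\<Union>n. {x \<in> {0..1}. (tent_map ^^ n) x = 1})"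
  proof (rule fsigma_in_Union)
    show "fsigma_in (top_of_set {0..1}) U" if "U \<in> range (\<lambda>n. {x \<in> {0..1}. (tent_map ^^ n) x = 1})" for U
      using that cl by (auto intro: closed_imp_fsigma_in)
  qed simp
  ultimately have "fsigma_in (top_of_set {0..1}) absorbed" by simp
  then show ?thesis
    using gdelta_in_diff[OF gdelta_in_topspace[of "top_of_set {0..1}"]] by simp
qed

lemma absorbed_not_irregular:
  assumes "x \<in> absorbed"
  shows "x \<notin> irregular_points tent_map"
proof -
  obtain K where K: "\<And>n. K \<le> n \<Longrightarrow> (tent_map ^^ n) x = 0"
    by (rule absorbed_orbit[OF assms]) blast
  have "convergent (visit_freq tent_map x A)" for A
    unfolding convergent_def visit_freq_eq_sum[abs_def]
    using average_eventually_const[of K "\<lambda>n. indicator A ((tent_map ^^ n) x)" "indicator A 0"] K by auto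
  then show ?thesis by (simp add: irregular_points_def)
qed

lemma continuous_on_visit_freq_cylinder:
  "continuous_on ({0..1} - absorbed) (\<lambda>x. visit_freq tent_map x (cylinder tent_map as) N)"
proof -
  let ?S = "{0..1} - absorbed"
  \<comment> \<open>The signum is continuous away from 0, so these expressions are continuous off
    1/2; they agree with the indicators of the half-intervals except at 1/2 and 1.\<close>
  let ?h = "\<lambda>a y. if a = 0 then (1 - sgn (y - 1/2)) / 2 else (1 + sgn (y - 1/2)) / 2 :: real"
  have half: "indicator (half_interval a) y = ?h a y"
    if "y \<in> {0..<1}" "y \<noteq> 1/2" for a y
    using that by (auto simp: half_interval_def indicator_def sgn_if)
  have cyl: "indicator (cylinder tent_map as) ((tent_map ^^ n) x)
      = (\<Prod>j<length as. ?h (as ! j) ((tent_map ^^ (j + n)) x))" if x: "x \<in> ?S" for x n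
  proof -
    have "indicator (cylinder tent_map as) ((tent_map ^^ n) x)
        = (\<Prod>j<length as. indicator (half_interval (as ! j)) ((tent_map ^^ (j + n)) x) :: real)"
      using tent_map_funpow_in[of x n] x
      by (auto simp: cylinder_def indicator_def funpow_add intro!: prod.neutral[symmetric])
    also have "\<dots> = (\<Prod>j<length as. ?h (as ! j) ((tent_map ^^ (j + n)) x))"
      using not_absorbed_orbit[OF x] by (intro prod.cong refl half)
    finally show ?thesis .
  qed
  have "continuous_on ?S (\<lambda>x. (\<Sum>n<N. \<Prod>j<length as. ?h (as ! j) ((tent_map ^^ (j + n)) x)) / real N)"
  proof -
    have "continuous_on ?S (\<lambda>x. ?h a ((tent_map ^^ n) x))" for a n
      using not_absorbed_orbit(2)
      by (cases "a = 0") (auto intro!: continuous_intros continuous_on_funpow_tent_map)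
    then show ?thesis
      unfolding divide_inverse[of "sum _ _"] by (intro continuous_on_mult_right continuous_on_sum continuous_on_prod)
  qed
  then show ?thesis
    by (rule continuous_on_cong[THEN iffD1, rotated -1]) (simp_all only: visit_freq_eq_sum cyl)
qed

text \<open>Absorbed points have convergent frequencies, so only the other points matter. On these
  the frequencies are continuous, and divergence is a countable union over words and
  tolerances.\<close>

lemma Sigma0_3_irregular: "Sigma0 (top_of_set {0..1}) 3 (irregular_points tent_map)"
proof -
  let ?S = "{0..1} - absorbed"
  let ?v = "\<lambda>as x. visit_freq tent_map x (cylinder tent_map as)"
  let ?W = "{as. as \<noteq> [] \<and> set as \<subseteq> {0, 1}} :: nat list set"
  let ?G = "\<lambda>(as, k :: nat). {x \<in> ?S. \<forall>M. \<exists>p\<in>{M..} \<times> {M..}. 1 / real (Suc k) < \<bar>?v as x (fst p) - ?v as x (snd p)\<bar>}"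
  have "Sigma0 (top_of_set {0..1}) 3 (\<Union>i\<in>?W \<times> UNIV. ?G i)"
  proof (rule Sigma0_3_UN)
    fix i :: "nat list \<times> nat"
    obtain as k where i: "i = (as, k)" by (cases i)
    have "continuous_on ?S (\<lambda>x. \<bar>?v as x (fst p) - ?v as x (snd p)\<bar>)" for p
      by (intro continuous_intros continuous_on_visit_freq_cylinder)
    from gdelta_in_frequently_greater[OF this, where P = "\<lambda>M. {M..} \<times> {M..}" and c = "1 / real (Suc k)"]
    have "gdelta_in (top_of_set ?S) (?G i)" by (simp only: i prod.case)
    \<comment> \<open>The points that are not absorbed form a \<open>G\<^sub>\<delta>\<close> set,
      so a relative \<open>G\<^sub>\<delta>\<close> subset of it is one in the interval.\<close>
    moreover have "top_of_set ?S = subtopology (top_of_set {0..1}) ?S"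
      by (simp add: subtopology_subtopology Int_absorb1)
    ultimately show "gdelta_in (top_of_set {0..1}) (?G i)"
      using gdelta_in_gdelta_subtopology[OF gdelta_in_not_absorbed] by simp
  qed simp
  also have "(\<Union>i\<in>?W \<times> UNIV. ?G i) = irregular_points tent_map"
  proof (intro set_eqI)
    fix x
    define Q where "Q as k \<longleftrightarrow> (\<forall>M. \<exists>p\<in>{M..} \<times> {M..}. 1 / real (Suc k) < \<bar>?v as x (fst p) - ?v as x (snd p)\<bar>)"
      for as and k :: nat
    have "x \<in> ?G i \<longleftrightarrow> x \<in> ?S \<and> Q (fst i) (snd i)" for i
      by (cases i) (simp only: Q_def prod.case fst_conv snd_conv mem_Collect_eq)
    then have "x \<in> (\<Union>i\<in>?W \<times> UNIV. ?G i) \<longleftrightarrow> x \<in> ?S \<and> (\<exists>as\<in>?W. \<exists>k. Q as k)"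
      by (simp only: UN_iff) force
    also have "\<dots> \<longleftrightarrow> x \<in> ?S \<and> (\<exists>as\<in>?W. \<not> convergent (?v as x))"
      unfolding not_convergent_iff_frequently Q_def ..
    also have "\<dots> \<longleftrightarrow> x \<in> irregular_points tent_map"
    proof -
      have "x \<in> irregular_points tent_map \<longleftrightarrow> x \<in> {0..1} \<and> (\<exists>as\<in>?W. \<not> convergent (?v as x))"
        by (simp only: irregular_points_def mem_Collect_eq bex_simps Bex_def conj_assoc)
      with absorbed_not_irregular[of x] show ?thesis by (simp only: Diff_iff) argo
    qed
    finally show "x \<in> (\<Union>i\<in>?W \<times> UNIV. ?G i) \<longleftrightarrow> x \<in> irregular_points tent_map" .
  qed
  finally show ?thesis .
qed

text \<open>On each half-interval the tent map is affine of slope 2 or -2, so every further common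
  symbol halves the possible distance.\<close>

lemma cylinder_diameter:
  assumes "y \<in> cylinder tent_map w" "y' \<in> cylinder tent_map w"
  shows "\<bar>y - y'\<bar> \<le> (1/2) ^ length w"
  using assms
proof (induction w arbitrary: y y')
  case Nil
  then show ?case by (auto simp: cylinder_def)
next
  case (Cons a w)
  have Cons_cyl: "u \<in> half_interval a \<and> tent_map u \<in> cylinder tent_map w" if "u \<in> cylinder tent_map (a # w)" for u
  proof -
    have u: "u \<in> {0..1}" "\<And>j. j < Suc (length w) \<Longrightarrow> (tent_map ^^ j) u \<in> half_interval ((a # w) ! j)"
      using that by (auto simp: cylinder_def)
    have "(tent_map ^^ j) (tent_map u) \<in> half_interval (w ! j)" if "j < length w" for j
      using u(2)[of "Suc j"] that by (simp add: funpow_swap1)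
    with u(1) u(2)[of 0] tent_map_in show ?thesis by (simp add: cylinder_def)
  qed
  from Cons.prems have "\<bar>tent_map y - tent_map y'\<bar> \<le> (1/2) ^ length w"
    using Cons_cyl by (intro Cons.IH) blast+
  moreover have "\<bar>tent_map y - tent_map y'\<bar> = 2 * \<bar>y - y'\<bar>"
    using Cons_cyl[OF Cons.prems(1)] Cons_cyl[OF Cons.prems(2)]
    by (cases "a = 0") (auto simp: half_interval_def tent_map_def abs_if split: if_splits)
  ultimately show ?case by simp
qed

text \<open>Up to an error \<open>2 ^ -m\<close>, the average of the orbit is a combination of the frequencies of
  visits to the cylinders of length \<open>m\<close>.\<close>

lemma irregular_if_average_diverges:
  assumes x: "x \<in> {0..1}" and div: "\<not> convergent (\<lambda>N. power_sum 1 x N / real N)"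
  shows "x \<in> irregular_points tent_map"
proof (rule ccontr)
  assume "x \<notin> irregular_points tent_map"
  then have conv: "convergent (visit_freq tent_map x (cylinder tent_map w))"
    if "w \<noteq> []" "set w \<subseteq> {0, 1}" for w
    using that x by (auto simp: irregular_points_def)
  let ?avg = "\<lambda>N. power_sum 1 x N / real N"
  \<comment> \<open>An orbit has a symbol at every time only if it never meets 1, which lies in
    neither half-interval.\<close>
  have "x \<notin> absorbed"
  proof
    assume "x \<in> absorbed"
    then obtain K where K: "\<And>n. K \<le> n \<Longrightarrow> (tent_map ^^ n) x = 0"
      using absorbed_orbit by blast
    have "?avg \<longlonglongrightarrow> 0"
      unfolding power_sum_def power_one_right using K by (rule average_eventually_const)
    with div show False by (auto simp: convergent_def)
  qed
  with x have x': "x \<in> {0..1} - absorbed" by simp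
  have approx: "\<exists>G. convergent G \<and> (\<forall>N. \<bar>?avg N - G N\<bar> \<le> (1/2) ^ m)" if m: "0 < m" for m
  proof -
    define W where "W = {w :: nat list. set w \<subseteq> {0, 1} \<and> length w = m}"
    have fin: "finite W" unfolding W_def by (rule finite_lists_length_eq) simp
    \<comment> \<open>A sample point of the cylinder. For an empty cylinder its value is arbitrary,
      but no such word occurs among the \<open>u n\<close>.\<close>
    define c where "c w = (SOME y. y \<in> cylinder tent_map w)" for w
    define u where "u n = map (\<lambda>j. if (tent_map ^^ (j + n)) x < 1/2 then 0 else 1 :: nat) [0..<m]" for n
    have u_W: "u n \<in> W" for n
      by (auto simp: u_def W_def)
    have u_iff: "(tent_map ^^ n) x \<in> cylinder tent_map w \<longleftrightarrow> w = u n" if w: "w \<in> W" for w n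
    proof -
      have "(tent_map ^^ n) x \<in> cylinder tent_map w
          \<longleftrightarrow> (\<forall>j<m. (tent_map ^^ (j + n)) x \<in> half_interval (w ! j))"
        using tent_map_funpow_in[OF x, of n] w by (simp add: cylinder_def W_def funpow_add)
      also have "\<dots> \<longleftrightarrow> (\<forall>j<m. w ! j = u n ! j)"
      proof (intro all_cong1 imp_cong refl)
        fix j assume j: "j < m"
        have "w ! j \<in> set w" using j w by (intro nth_mem) (simp add: W_def)
        then have "w ! j = 0 \<or> w ! j = 1" using w by (auto simp: W_def)
        then show "(tent_map ^^ (j + n)) x \<in> half_interval (w ! j) \<longleftrightarrow> w ! j = u n ! j"
          using not_absorbed_orbit(1)[OF x', of "j + n"] j by (auto simp: u_def half_interval_def)
      qed
      also have "\<dots> \<longleftrightarrow> w = u n"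
        using w u_W[of n] by (auto simp: list_eq_iff_nth_eq W_def)
      finally show ?thesis .
    qed
    have close: "\<bar>(tent_map ^^ n) x - c (u n)\<bar> \<le> (1/2) ^ m" for n
    proof -
      have "(tent_map ^^ n) x \<in> cylinder tent_map (u n)" using u_iff[OF u_W] by simp
      moreover from this have "c (u n) \<in> cylinder tent_map (u n)" unfolding c_def by (rule someI)
      ultimately show ?thesis using cylinder_diameter[of _ "u n"] u_W[of n] by (auto simp: W_def)
    qed
    define G where "G N = (\<Sum>w\<in>W. c w * visit_freq tent_map x (cylinder tent_map w) N)" for N
    have "convergent G"
      unfolding G_def[abs_def]
    proof (intro convergent_sum convergent_mult convergent_const conv)
      show "w \<noteq> []" "set w \<subseteq> {0, 1}" if "w \<in> W" for w
        using that m by (auto simp: W_def)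
    qed
    moreover have "\<bar>?avg N - G N\<bar> \<le> (1/2) ^ m" for N
    proof (cases "N = 0")
      case False
      have "G N = (\<Sum>w\<in>W. \<Sum>n<N. c w * indicator (cylinder tent_map w) ((tent_map ^^ n) x)) / real N"
        by (simp only: G_def visit_freq_eq_sum times_divide_eq_right sum_distrib_left sum_divide_distrib)
      also have "(\<Sum>w\<in>W. \<Sum>n<N. c w * indicator (cylinder tent_map w) ((tent_map ^^ n) x))
          = (\<Sum>n<N. \<Sum>w\<in>W. c w * indicator (cylinder tent_map w) ((tent_map ^^ n) x))"
        by (rule sum.swap)
      also have "\<dots> = (\<Sum>n<N. c (u n))"
      proof (intro sum.cong refl)
        fix n
        have "(\<Sum>w\<in>W. c w * indicator (cylinder tent_map w) ((tent_map ^^ n) x))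
            = (\<Sum>w\<in>W. if w = u n then c w else 0)"
          using u_iff by (intro sum.cong refl) (simp add: indicator_def)
        also have "\<dots> = c (u n)" using fin u_W[of n] by simp
        finally show "(\<Sum>w\<in>W. c w * indicator (cylinder tent_map w) ((tent_map ^^ n) x)) = c (u n)" .
      qed
      finally have "?avg N - G N = (\<Sum>n<N. (tent_map ^^ n) x - c (u n)) / real N"
        by (simp add: power_sum_def sum_subtractf diff_divide_distrib)
      moreover have "\<bar>\<Sum>n<N. (tent_map ^^ n) x - c (u n)\<bar> \<le> (\<Sum>n<N. (1/2) ^ m)"
        using close by (intro sum_abs[THEN order_trans] sum_mono)
      ultimately show ?thesis
        using False by (simp add: abs_divide divide_le_eq mult.commute)
    qed (simp add: G_def visit_freq_def)
    ultimately show ?thesis by blast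
  qed
  have "Cauchy ?avg"
    unfolding Cauchy_def
  proof (intro allI impI)
    fix e :: real assume e: "0 < e"
    obtain m where "(1/2 :: real) ^ m < e / 3"
      using real_arch_pow_inv[of "e/3" "1/2"] e by auto
    \<comment> \<open>The length is raised by one because irregularity speaks of nonempty words
      only.\<close>
    moreover have "(1/2 :: real) ^ Suc m \<le> (1/2) ^ m" by simp
    ultimately have m: "(1/2 :: real) ^ Suc m < e / 3" by linarith
    obtain G where G: "convergent G" "\<And>N. \<bar>?avg N - G N\<bar> \<le> (1/2) ^ Suc m"
      using approx[of "Suc m"] by auto
    obtain M where M: "\<And>k n. M \<le> k \<Longrightarrow> M \<le> n \<Longrightarrow> dist (G k) (G n) < e / 3"
      using convergent_Cauchy[OF G(1)] e unfolding Cauchy_def by (metis zero_less_divide_iff zero_less_numeral)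
    have "dist (?avg k) (?avg n) < e" if "M \<le> k" "M \<le> n" for k n
      using M[OF that] G(2)[of k] G(2)[of n] m unfolding dist_real_def by linarith
    then show "\<exists>M. \<forall>k\<ge>M. \<forall>n\<ge>M. dist (?avg k) (?avg n) < e" by blast
  qed
  with div show False by (simp add: Cauchy_convergent_iff)
qed

text \<open>A Markov estimate: membership in a cylinder is constant near 0, and away from 0 an error
  of 1 is at most \<open>d * y\<close>. So the frequency differs from that constant by at most
  \<open>d\<close> times the orbit average.\<close>

lemma regular_if_average_vanishes:
  assumes x: "x \<in> {0..1}" and lim: "(\<lambda>N. power_sum 1 x N / real N) \<longlonglongrightarrow> 0"
  shows "x \<notin> irregular_points tent_map"
proof -
  have "convergent (visit_freq tent_map x (cylinder tent_map w))" for w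
  proof -
    define d :: real where "d = 2 ^ length w"
    \<comment> \<open>A point below \<open>1 / d\<close> doubles at each step and stays in the left
      half for \<open>length w\<close> steps, so it lies in the cylinder exactly if all symbols are
      0.\<close>
    define t :: real where "t = of_bool (\<forall>j<length w. w ! j = 0)"
    have d: "0 < d" by (simp add: d_def)
    have pow: "(tent_map ^^ j) y = 2 ^ j * y \<and> (j < length w \<longrightarrow> 2 ^ j * y < 1/2)"
      if y: "0 \<le> y" "d * y < 1" "j \<le> length w" for y j
      using y(3)
    proof (induction j)
      case 0
      show ?case
      proof (cases "length w")
        case (Suc k)
        have "1 * y \<le> 2 ^ k * y" using y(1) by (intro mult_right_mono) simp_all
        then show ?thesis using y(2) by (simp add: d_def Suc)
      qed simp
    next
      case (Suc j)
      then have "(tent_map ^^ j) y = 2 ^ j * y" "2 ^ j * y < 1/2" by simp_all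
      then have "(tent_map ^^ Suc j) y = 2 ^ Suc j * y" by (simp add: tent_map_def)
      moreover have "2 ^ Suc j * y < 1/2" if "Suc j < length w"
      proof -
        have "2 * 2 ^ Suc j * y \<le> d * y"
          unfolding d_def power_Suc[symmetric] using that y(1)
          by (intro mult_right_mono power_increasing) simp_all
        with y(2) show ?thesis by simp
      qed
      ultimately show ?case by blast
    qed
    have near: "indicator (cylinder tent_map w) y = t" if y: "y \<in> {0..1}" "d * y < 1" for y
    proof -
      have "(tent_map ^^ j) y \<in> half_interval (w ! j) \<longleftrightarrow> w ! j = 0" if "j < length w" for j
        using pow[of y j] y that by (auto simp: half_interval_def)
      then show ?thesis
        using y(1) by (auto simp: indicator_def cylinder_def t_def)
    qed
    have diff: "\<bar>indicator (cylinder tent_map w) y - t\<bar> \<le> d * y" if y: "y \<in> {0..1}" for y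
    proof (cases "d * y < 1")
      case True
      then show ?thesis using near[OF y True] d y by simp
    next
      case False
      have "\<bar>indicator (cylinder tent_map w) y - t\<bar> \<le> 1"
        by (auto simp: indicator_def t_def)
      with False show ?thesis by linarith
    qed
    have "(\<lambda>N. visit_freq tent_map x (cylinder tent_map w) N - t) \<longlonglongrightarrow> 0"
    proof (rule Lim_null_comparison)
      show "(\<lambda>N. d * (power_sum 1 x N / real N)) \<longlonglongrightarrow> 0"
        using lim by (rule tendsto_mult_right_zero)
      show "\<forall>\<^sub>F N in sequentially. norm (visit_freq tent_map x (cylinder tent_map w) N - t)
          \<le> d * (power_sum 1 x N / real N)"
        using eventually_gt_at_top[of 0]
      proof eventually_elim
        case (elim N)
        have "visit_freq tent_map x (cylinder tent_map w) N - t
            = (\<Sum>n<N. indicator (cylinder tent_map w) ((tent_map ^^ n) x) - t) / real N"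
          using elim by (simp add: visit_freq_eq_sum sum_subtractf diff_divide_distrib)
        moreover have "\<bar>\<Sum>n<N. indicator (cylinder tent_map w) ((tent_map ^^ n) x) - t\<bar>
            \<le> (\<Sum>n<N. d * (tent_map ^^ n) x)"
          using diff[OF tent_map_funpow_in[OF x]] by (intro sum_abs[THEN order_trans] sum_mono)
        ultimately show ?case
          by (simp add: power_sum_def abs_divide sum_distrib_left divide_right_mono)
      qed
    qed
    then show ?thesis
      using LIM_zero_cancel by (auto simp: convergent_def)
  qed
  then show ?thesis by (simp add: irregular_points_def)
qed

text \<open>The point mass at the fixed point 0 is the measure whose first moment vanishes, as
  \<open>regular_if_average_vanishes\<close> requires.\<close>

lemma invariant_measure_return: "invariant_measure (return (restrict_space borel {0..1}) 0)"
proof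
  let ?R = "restrict_space borel {0..1 :: real}"
  have sp: "space ?R = {0..1}" by (simp add: space_restrict_space)
  show "borel_probability (return ?R 0)"
    unfolding borel_probability_def by (intro conjI prob_space_return) (simp_all add: sp)
  show "invariant_for tent_map (return ?R 0)"
    unfolding invariant_for_def
  proof
    fix B assume B: "B \<in> sets ?R"
    have "tent_map -` B \<inter> {0..1} \<in> sets ?R"
      using measurable_sets[OF tent_map_measurable_restrict B] by (simp add: sp)
    then show "measure (return ?R 0) B = measure (return ?R 0) (tent_map -` B \<inter> {0..1})"
      using B by (simp add: measure_return indicator_def tent_map_def)
  qed
qed

text \<open>For the point mass at 0, the reduction yields averages that tend to 0 or diverge; these
  two cases are regular and irregular points, so the regular points inherit the complexity of the
  sequences tending to infinity.\<close>

lemma not_Pi0_3_irregular: "\<not> Pi0 (top_of_set {0..1}) 3 (irregular_points tent_map)"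
proof -
  let ?R = "restrict_space borel {0..1 :: real}"
  interpret R: invariant_measure "return ?R 0" by (rule invariant_measure_return)
  have "R.moment 1 = 0"
    unfolding R.moment_def using R.measurable_from_borel[of borel "\<lambda>x. x"]
    by (subst integral_return) (simp_all add: space_restrict_space)
  moreover obtain f :: "(nat \<Rightarrow> nat) \<Rightarrow> real" where f: "\<And>z. f z \<in> {0..1}"
    "\<And>V z. openin (top_of_set {0..1}) V \<Longrightarrow> f z \<in> V \<Longrightarrow> \<exists>n. \<forall>z'. (\<forall>i<n. z' i = z i) \<longrightarrow> f z' \<in> V"
    "\<And>z j. (\<And>k. finite {j. z j = k}) \<Longrightarrow> (\<lambda>N. power_sum j (f z) N / real N) \<longlonglongrightarrow> R.moment j"
    "\<And>z k. infinite {j. z j = k} \<Longrightarrow> \<not> convergent (\<lambda>N. power_sum 1 (f z) N / real N)"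
    by (rule R.reduction) blast
  ultimately have "f z \<in> {0..1} - irregular_points tent_map \<longleftrightarrow> (\<forall>k. finite {j. z j = k})" for z
    using f(1)[of z] f(3)[of z 1] f(4)[of z] regular_if_average_vanishes[OF f(1)[of z]]
      irregular_if_average_diverges[OF f(1)[of z]] by (metis DiffD2 DiffI)
  then have "\<not> Sigma0 (top_of_set {0..1}) 3 ({0..1} - irregular_points tent_map)"
    by (intro not_Sigma0_3[of _ f, OF f(2)])
  then show ?thesis by (simp add: Pi0_def)
qed

theorem corollary19:
  shows "(\<forall>\<mu>. borel_probability \<mu> \<and> invariant_for tent_map \<mu>
            \<longrightarrow> Pi03_complete (top_of_set {0..1}) (basin tent_map \<mu>))
       \<and> Sigma03_complete (top_of_set {0..1}) (irregular_points tent_map)"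
proof (intro conjI allI impI)
  fix \<mu> assume "borel_probability \<mu> \<and> invariant_for tent_map \<mu>"
  then interpret invariant_measure \<mu> by unfold_locales simp_all
  show "Pi03_complete (top_of_set {0..1}) (basin tent_map \<mu>)"
    unfolding Pi03_complete_def using Pi0_3_basin not_Sigma0_3_basin by simp
next
  show "Sigma03_complete (top_of_set {0..1}) (irregular_points tent_map)"
    unfolding Sigma03_complete_def using Sigma0_3_irregular not_Pi0_3_irregular by simp
qed

end
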